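(* For all integers $r,s,t$ with $1\le r\le s$ and $t\ge 2$, $$\chi_r(W(s,t))=t+2(r-1).$$
   Context: Graphs are finite, simple and undirected. For positive integers $s,t$ the graph $W(s,t)$ has vertex set consisting of all sequences $(x_1,\dots,x_t)$ with $x_i\in\{0,1,\dots,s\}$ for all $i$, such that there is exactly one index $i$ with $x_i=0$ and at least one index $j$ with $x_j=1$. Two vertices $(x_1,\dots,x_t)$ and $(y_1,\dots,y_t)$ are adjacent if and only if for every $i$ either $|x_i-y_i|=1$ or $x_i=y_i=s$. For a graph $G$ and a positive integer $r$, the $r$-fold chromatic number ($r$-th multichromatic number) $\chi_r(G)$ is the minimum $n$ such that one can assign to each vertex of $G$ a set of exactly $r$ distinct colors from $\{1,\dots,n\}$ in such a way that adjacent vertices receive disjoint sets. (Equivalently, $G$ admits a homomorphism to the Kneser graph whose vertices are the $r$-element subsets of $\{1,\dots,n\}$, two being adjacent if and only if they are disjoint.) *)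

theory Defs
  imports "Graph_Theory.Pair_Digraph"
begin

text \<open>
  A finite simple undirected graph is a \<^locale>\<open>pair_graph\<close>: finite, loop-free and symmetric.
\<close>

text \<open>
  Sequences are 0-indexed lists. The entries are compared in \<^typ>\<open>int\<close>, because subtraction on
  \<^typ>\<open>nat\<close> truncates.
\<close>

definition W_verts :: "nat \<Rightarrow> nat \<Rightarrow> nat list set" where
  "W_verts s t =
     {x. length x = t \<and> (\<forall>i<t. x ! i \<in> {0..s}) \<and>
         (\<exists>!i. i < t \<and> x ! i = 0) \<and> (\<exists>j<t. x ! j = 1)}"

definition W :: "nat \<Rightarrow> nat \<Rightarrow> nat list pair_pre_digraph" where
  "W s t =
     \<lparr> pverts = W_verts s t,
       parcs = {(x, y). x \<in> W_verts s t \<and> y \<in> W_verts s t \<and>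
                  (\<forall>i<t. \<bar>int (x ! i) - int (y ! i)\<bar> = 1 \<or> (x ! i = s \<and> y ! i = s))} \<rparr>"

definition fold_coloring :: "nat \<Rightarrow> nat \<Rightarrow> 'a pair_pre_digraph \<Rightarrow> ('a \<Rightarrow> nat set) \<Rightarrow> bool" where
  "fold_coloring r n G c \<longleftrightarrow>
     (\<forall>v \<in> pverts G. c v \<subseteq> {1..n} \<and> card (c v) = r) \<and>
     (\<forall>(u, v) \<in> parcs G. c u \<inter> c v = {})"

definition fold_chromatic_number :: "nat \<Rightarrow> 'a pair_pre_digraph \<Rightarrow> nat" where
  "fold_chromatic_number r G = (LEAST n. \<exists>c. fold_coloring r n G c)"

lemma parcs_W_iff:
  "(x, y) \<in> parcs (W s t) \<longleftrightarrow> x \<in> W_verts s t \<and> y \<in> W_verts s t \<and>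
     (\<forall>i<t. \<bar>int (x ! i) - int (y ! i)\<bar> = 1 \<or> (x ! i = s \<and> y ! i = s))"
  by (simp add: W_def)

lemma pverts_W: "pverts (W s t) = W_verts s t"
  by (simp add: W_def)

lemma pair_graph_W:
  assumes "s \<ge> 1"
  shows "pair_graph (W s t)"
proof -
  have "W_verts s t \<subseteq> {x. set x \<subseteq> {0..s} \<and> length x = t}"
  proof
    fix x assume "x \<in> W_verts s t"
    then have "length x = t" "\<forall>i<t. x ! i \<in> {0..s}"
      unfolding W_verts_def by blast+
    then show "x \<in> {x. set x \<subseteq> {0..s} \<and> length x = t}"
      by (metis (mono_tags, lifting) in_set_conv_nth mem_Collect_eq subsetI)
  qed
  then have fin: "finite (W_verts s t)"
    by (rule finite_subset) (simp add: finite_lists_length_eq)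
  have sub: "parcs (W s t) \<subseteq> W_verts s t \<times> W_verts s t"
  proof
    fix e assume "e \<in> parcs (W s t)"
    then show "e \<in> W_verts s t \<times> W_verts s t"
      by (cases e) (simp add: parcs_W_iff)
  qed
  have fin_arcs: "finite (parcs (W s t))"
    by (rule finite_subset[OF sub]) (simp add: fin)
  have "sym (parcs (W s t))"
  proof (rule symI)
    fix x y assume "(x, y) \<in> parcs (W s t)"
    then show "(y, x) \<in> parcs (W s t)"
      unfolding parcs_W_iff by (metis abs_minus_commute)
  qed
  then have symm: "symmetric (with_proj (W s t))"
    by (simp add: symmetric_def)
  have loopfree: "fst e \<noteq> snd e" if e: "e \<in> parcs (W s t)" for e
  proof
    assume eq: "fst e = snd e"
    define x where "x = fst e"
    have xx: "(x, x) \<in> parcs (W s t)"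
      using e eq by (cases e) (simp add: x_def)
    then have "x \<in> W_verts s t" by (simp only: parcs_W_iff)
    then obtain i where i: "i < t" "x ! i = 0" unfolding W_verts_def by blast
    from xx i(1) have "\<bar>int (x ! i) - int (x ! i)\<bar> = 1 \<or> x ! i = s"
      unfolding parcs_W_iff by blast
    with i(2) assms show False by simp
  qed
  show ?thesis
    by unfold_locales
      (use fin fin_arcs symm loopfree sub in \<open>auto simp only: pverts_W fst_conv snd_conv\<close>)
qed

text \<open>
  The minimum defining \<^const>\<open>fold_chromatic_number\<close> is attained for every finite simple graph,
  so the \<open>LEAST\<close> is never arbitrary there.
\<close>

lemma fold_coloring_fold_chromatic_number:
  assumes "pair_graph G"
  shows "\<exists>c. fold_coloring r (fold_chromatic_number r G) G c"
proof -
  interpret pair_graph G by fact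
  obtain f where f: "bij_betw f (pverts G) {0..<card (pverts G)}"
    using ex_bij_betw_finite_nat[OF pair_finite_verts] by blast
  define c where "c v = {f v * r + 1..f v * r + r}" for v
  have "c v \<subseteq> {1..card (pverts G) * r}" if "v \<in> pverts G" for v
  proof -
    have "f v < card (pverts G)"
      using bij_betwE[OF f] that by auto
    then have "Suc (f v) * r \<le> card (pverts G) * r"
      by (intro mult_right_mono) auto
    then show ?thesis by (auto simp: c_def)
  qed
  moreover have "c u \<inter> c v = {}" if "(u, v) \<in> parcs G" for u v
  proof -
    have "u \<in> pverts G" "v \<in> pverts G" "u \<noteq> v"
      using arc_fst_in_verts[OF that] arc_snd_in_verts[OF that] pair_no_loops[OF that] by simp_all
    then have ne: "f u \<noteq> f v"
      using f by (auto simp: bij_betw_def inj_on_def)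
    have sep: "a * r + r \<le> b * r" if "a < b" for a b :: nat
      using mult_le_mono1[of "Suc a" b r] that by (simp add: add.commute)
    have disj: "c x \<inter> c y = {}" if "f x < f y" for x y
      using sep[OF that] by (simp add: c_def disjoint_iff)
    from ne consider "f u < f v" | "f v < f u" by linarith
    then show ?thesis
      using disj[of u v] disj[of v u] by cases auto
  qed
  ultimately have "fold_coloring r (card (pverts G) * r) G c"
    by (auto simp: fold_coloring_def c_def)
  then have "\<exists>n c. fold_coloring r n G c" by blast
  then show ?thesis
    unfolding fold_chromatic_number_def by (rule LeastI_ex)
qed

end

theory Submission
  imports Defs "HOL-Library.Multiset" "HOL-Library.Sublist" "HOL-Library.Z2"
begin

text \<open>
  Lower bound. Stahl's map between Kneser graphs shows that the multichromatic number grows by at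
  least 2 when \<open>r\<close> grows by 1, so that it remains to show that \<open>W(s,t)\<close> has no proper colouring
  with fewer than \<open>t\<close> colours. The complete bipartite subgraphs of \<open>W(s,t)\<close> are the simplices of a
  complex with a free involution. By induction on \<open>t\<close> it contains the mod 2 hemisphere chains of a
  sphere of dimension \<open>t - 1\<close>: \<open>W(s,t)\<close> is the equator \<open>x\<^sub>1 = s\<close> of \<open>W(s,t+1)\<close>, and it can be
  contracted inside of the hemisphere on one side. By the counting argument of Fan, a proper colouring
  of a graph with this property has a simplex with \<open>t\<close> colours.

  Upper bound. There are \<open>t + 2(r - 1)\<close> independent sets which cover every vertex at least \<open>r\<close>
  times. The coordinate \<open>k\<close> gives the set of all \<open>x\<close> for which \<open>x\<^sub>k < s\<close> is even (slightly enlarged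
  if \<open>s\<close> is even). The other sets come in \<open>r - 1\<close> pairs, and a vertex which is missed by a pair is
  covered once more by a coordinate.
\<close>

section \<open>Chains modulo 2\<close>

declare add_bit_eq_xor [simp del]

lemma bit_double [simp]: "(a :: bit) + a = 0"
  by (cases a) (simp_all add: add_bit_eq_xor)

lemma bit_double_left [simp]: "(a :: bit) + (a + b) = b"
  by (cases a) (simp_all add: add_bit_eq_xor)

text \<open>The simplicial coboundary: a sum over all deletions of one entry, with the deletion of
  the head split off.\<close>

primrec coboundary :: "('v list \<Rightarrow> bit) \<Rightarrow> 'v list \<Rightarrow> bit" where
  "coboundary F [] = 0"
| "coboundary F (v # \<sigma>) = F \<sigma> + coboundary (\<lambda>\<rho>. F (v # \<rho>)) \<sigma>"

lemma coboundary_add: "coboundary (\<lambda>\<rho>. F \<rho> + G \<rho>) \<sigma> = coboundary F \<sigma> + coboundary G \<sigma>"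
  by (induction \<sigma> arbitrary: F G) (simp_all add: ac_simps)

lemma coboundary_zero [simp]: "coboundary (\<lambda>_. 0) \<sigma> = 0"
  by (induction \<sigma>) simp_all

lemma coboundary_map: "coboundary (\<lambda>\<rho>. F (map f \<rho>)) = (\<lambda>\<sigma>. coboundary F (map f \<sigma>))"
proof
  show "coboundary (\<lambda>\<rho>. F (map f \<rho>)) \<sigma> = coboundary F (map f \<sigma>)" for \<sigma>
    by (induction \<sigma> arbitrary: F) simp_all
qed

lemma coboundary_cong:
  assumes "\<And>\<rho>. subseq \<rho> \<sigma> \<Longrightarrow> length \<sigma> = Suc (length \<rho>) \<Longrightarrow> F \<rho> = G \<rho>"
  shows "coboundary F \<sigma> = coboundary G \<sigma>"
  using assms
proof (induction \<sigma> arbitrary: F G)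
  case (Cons v \<sigma>)
  have "F \<sigma> = G \<sigma>" by (rule Cons.prems) auto
  moreover have "coboundary (\<lambda>\<rho>. F (v # \<rho>)) \<sigma> = coboundary (\<lambda>\<rho>. G (v # \<rho>)) \<sigma>"
    by (rule Cons.IH, rule Cons.prems) auto
  ultimately show ?case by simp
qed simp

text \<open>The transpose of the prism operator of a simplicial homotopy from \<open>f\<close> to \<open>g\<close>.\<close>

primrec prism :: "('v \<Rightarrow> 'w) \<Rightarrow> ('v \<Rightarrow> 'w) \<Rightarrow> ('w list \<Rightarrow> bit) \<Rightarrow> 'v list \<Rightarrow> bit" where
  "prism f g F [] = 0"
| "prism f g F (v # \<sigma>) = F (f v # g v # map g \<sigma>) + prism f g (\<lambda>\<rho>. F (f v # \<rho>)) \<sigma>"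

lemma prism_add: "prism f g (\<lambda>\<rho>. F \<rho> + G \<rho>) = (\<lambda>\<sigma>. prism f g F \<sigma> + prism f g G \<sigma>)"
proof
  show "prism f g (\<lambda>\<rho>. F \<rho> + G \<rho>) \<sigma> = prism f g F \<sigma> + prism f g G \<sigma>" for \<sigma>
    by (induction \<sigma> arbitrary: F G) (simp_all add: ac_simps)
qed

text \<open>The side faces of the prism over \<open>\<sigma>\<close> are the prisms over the faces
  of \<open>\<sigma>\<close>, the inner faces occur twice, and only top and bottom remain.\<close>

lemma prism_coboundary:
  "prism f g (coboundary F) \<sigma> + coboundary (prism f g F) \<sigma> = F (map f \<sigma>) + F (map g \<sigma>)"
proof (induction \<sigma> arbitrary: F)
  case (Cons v \<sigma>)
  have "prism f g (coboundary F) (v # \<sigma>) + coboundary (prism f g F) (v # \<sigma>) =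
      F (map g (v # \<sigma>)) + F (f v # map g \<sigma>) +
      (prism f g (coboundary (\<lambda>\<rho>. F (f v # \<rho>))) \<sigma> + coboundary (prism f g (\<lambda>\<rho>. F (f v # \<rho>))) \<sigma>)"
    by (simp add: prism_add coboundary_add ac_simps
        coboundary_map[of "\<lambda>\<rho>. F (f v # g v # \<rho>)"])
  also have "\<dots> = F (map f (v # \<sigma>)) + F (map g (v # \<sigma>))"
    by (simp only: Cons.IH) (simp add: ac_simps)
  finally show ?case .
qed simp

lemma prism_cong:
  assumes "\<And>\<rho>. length \<rho> = Suc (length \<sigma>) \<Longrightarrow> set \<rho> \<subseteq> f ` set \<sigma> \<union> g ` set \<sigma> \<Longrightarrow> F \<rho> = G \<rho>"
  shows "prism f g F \<sigma> = prism f g G \<sigma>"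
  using assms
proof (induction \<sigma> arbitrary: F G)
  case (Cons v \<sigma>)
  have "F (f v # g v # map g \<sigma>) = G (f v # g v # map g \<sigma>)" by (rule Cons.prems) auto
  moreover have "prism f g (\<lambda>\<rho>. F (f v # \<rho>)) \<sigma> = prism f g (\<lambda>\<rho>. G (f v # \<rho>)) \<sigma>"
    by (rule Cons.IH, rule Cons.prems) auto
  ultimately show ?case by simp
qed simp

section \<open>Chains, homologies and cones\<close>

text \<open>
  A chain modulo 2 is represented by the linear functional which it induces on cochains. A simplex
  is a list, possibly with repetitions, whose set of vertices belongs to the complex \<open>K\<close>; the
  number \<open>k\<close> is its length, so that the dimension is \<open>k - 1\<close>.
\<close>

definition chain :: "'v set set \<Rightarrow> nat \<Rightarrow> (('v list \<Rightarrow> bit) \<Rightarrow> bit) \<Rightarrow> bool" where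
  "chain K k c \<longleftrightarrow>
     (\<forall>F G. c (\<lambda>\<sigma>. F \<sigma> + G \<sigma>) = c F + c G) \<and>
     (\<forall>F G. (\<forall>\<sigma>. length \<sigma> = k \<longrightarrow> set \<sigma> \<in> K \<longrightarrow> F \<sigma> = G \<sigma>) \<longrightarrow> c F = c G)"

lemma chain_addD: "chain K k c \<Longrightarrow> c (\<lambda>\<sigma>. F \<sigma> + G \<sigma>) = c F + c G"
  by (simp add: chain_def)

lemma chain_cong:
  assumes "chain K k c" "\<And>\<sigma>. length \<sigma> = k \<Longrightarrow> set \<sigma> \<in> K \<Longrightarrow> F \<sigma> = G \<sigma>"
  shows "c F = c G"
  using assms unfolding chain_def by blast

lemma chain_zero:
  assumes "chain K k c"
  shows "c (\<lambda>_. 0) = 0"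
  using chain_addD[OF assms, of "\<lambda>_. 0" "\<lambda>_. 0"] by simp

lemma chain_single: "set \<sigma> \<in> K \<Longrightarrow> length \<sigma> = k \<Longrightarrow> chain K k (\<lambda>F. F \<sigma>)"
  by (simp add: chain_def)

lemma chain_add:
  assumes c: "chain K k c" and d: "chain K k d"
  shows "chain K k (\<lambda>F. c F + d F)"
  unfolding chain_def
proof (intro conjI allI impI)
  show "c F + d F = c G + d G"
    if "\<forall>\<sigma>. length \<sigma> = k \<longrightarrow> set \<sigma> \<in> K \<longrightarrow> F \<sigma> = G \<sigma>" for F G
    using chain_cong[OF c, of F G] chain_cong[OF d, of F G] that by simp
qed (simp add: chain_addD[OF c] chain_addD[OF d] ac_simps)

lemma chain_map:
  assumes c: "chain K k c" and f: "\<And>A. A \<in> K \<Longrightarrow> f ` A \<in> L"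
  shows "chain L k (\<lambda>F. c (\<lambda>\<sigma>. F (map f \<sigma>)))"
  unfolding chain_def
proof (intro conjI allI impI)
  show "c (\<lambda>\<sigma>. F (map f \<sigma>)) = c (\<lambda>\<sigma>. G (map f \<sigma>))"
    if "\<forall>\<sigma>. length \<sigma> = k \<longrightarrow> set \<sigma> \<in> L \<longrightarrow> F \<sigma> = G \<sigma>" for F G
    by (rule chain_cong[OF c]) (use that f in simp)
qed (simp add: chain_addD[OF c])

text \<open>\<open>h (coboundary F)\<close> evaluates the boundary of \<open>h\<close> on
  \<open>F\<close>; so the images of \<open>z\<close> under \<open>f\<close> and \<open>g\<close>
  differ by a boundary in \<open>L\<close>.\<close>

definition homologous ::
    "'w set set \<Rightarrow> nat \<Rightarrow> (('v list \<Rightarrow> bit) \<Rightarrow> bit) \<Rightarrow> ('v \<Rightarrow> 'w) \<Rightarrow> ('v \<Rightarrow> 'w) \<Rightarrow> bool" where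
  "homologous L k z f g \<longleftrightarrow>
     (\<exists>h. chain L (Suc k) h \<and>
       (\<forall>F. h (coboundary F) = z (\<lambda>\<sigma>. F (map f \<sigma>)) + z (\<lambda>\<sigma>. F (map g \<sigma>))))"

lemma homologous_trans:
  assumes "homologous L k z f g" "homologous L k z g h"
  shows "homologous L k z f h"
proof -
  from assms obtain c d where
    c: "chain L (Suc k) c"
      "\<And>F. c (coboundary F) = z (\<lambda>\<sigma>. F (map f \<sigma>)) + z (\<lambda>\<sigma>. F (map g \<sigma>))" and
    d: "chain L (Suc k) d"
      "\<And>F. d (coboundary F) = z (\<lambda>\<sigma>. F (map g \<sigma>)) + z (\<lambda>\<sigma>. F (map h \<sigma>))"
    unfolding homologous_def by blast
  show ?thesis
    unfolding homologous_def
    by (rule exI[of _ "\<lambda>F. c F + d F"]) (simp add: c(2) d(2) chain_add[OF c(1) d(1)] ac_simps)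
qed

text \<open>Contiguity puts every list of the prism into a simplex of \<open>L\<close>. The sides of
  the prism lie over the boundary of \<open>z\<close>, which vanishes, so only the two images are
  left.\<close>

lemma contiguous_homologous:
  assumes z: "chain K k z" and cycle: "\<And>F. z (coboundary F) = 0"
    and L: "\<And>A. A \<in> K \<Longrightarrow> \<exists>B\<in>L. f ` A \<union> g ` A \<subseteq> B"
    and down: "\<And>A B. B \<in> L \<Longrightarrow> A \<subseteq> B \<Longrightarrow> A \<in> L"
  shows "homologous L k z f g"
proof -
  have "chain L (Suc k) (\<lambda>F. z (prism f g F))"
    unfolding chain_def
  proof (intro conjI allI impI)
    fix F G :: "'b list \<Rightarrow> bit"
    show "z (prism f g (\<lambda>\<sigma>. F \<sigma> + G \<sigma>)) = z (prism f g F) + z (prism f g G)"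
      unfolding prism_add by (rule chain_addD[OF z])
    assume FG: "\<forall>\<sigma>. length \<sigma> = Suc k \<longrightarrow> set \<sigma> \<in> L \<longrightarrow> F \<sigma> = G \<sigma>"
    show "z (prism f g F) = z (prism f g G)"
    proof (rule chain_cong[OF z])
      fix \<sigma> :: "'a list" assume \<sigma>: "length \<sigma> = k" "set \<sigma> \<in> K"
      show "prism f g F \<sigma> = prism f g G \<sigma>"
      proof (rule prism_cong)
        fix \<rho> assume \<rho>: "length \<rho> = Suc (length \<sigma>)" "set \<rho> \<subseteq> f ` set \<sigma> \<union> g ` set \<sigma>"
        obtain B where "B \<in> L" "f ` set \<sigma> \<union> g ` set \<sigma> \<subseteq> B" using L[OF \<sigma>(2)] ..
        then have "set \<rho> \<in> L" by (intro down[of B "set \<rho>"] order_trans[OF \<rho>(2)])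
        then show "F \<rho> = G \<rho>" using FG \<rho>(1) \<sigma>(1) by simp
      qed
    qed
  qed
  moreover have "z (prism f g (coboundary F)) = z (\<lambda>\<sigma>. F (map f \<sigma>)) + z (\<lambda>\<sigma>. F (map g \<sigma>))" for F
  proof -
    have "z (prism f g (coboundary F)) =
        z (\<lambda>\<sigma>. prism f g (coboundary F) \<sigma> + coboundary (prism f g F) \<sigma>)"
      by (simp only: chain_addD[OF z] cycle add_0_right)
    then show ?thesis
      by (simp only: prism_coboundary chain_addD[OF z])
  qed
  ultimately show ?thesis
    unfolding homologous_def by blast
qed

text \<open>In the boundary of the cone with apex \<open>a\<close>, the faces through
  \<open>a\<close> form the cone over the boundary of the cycle \<open>z\<close> and drop
  out.\<close>

lemma cone_bounds:
  assumes z: "chain K k z" and cycle: "\<And>F. z (coboundary F) = 0"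
    and L: "\<And>A. A \<in> K \<Longrightarrow> insert a (f ` A) \<in> L"
  shows "\<exists>h. chain L (Suc k) h \<and> (\<forall>F. h (coboundary F) = z (\<lambda>\<sigma>. F (map f \<sigma>)))"
proof (intro exI conjI allI)
  show "chain L (Suc k) (\<lambda>F. z (\<lambda>\<sigma>. F (a # map f \<sigma>)))"
    unfolding chain_def
  proof (intro conjI allI impI)
    show "z (\<lambda>\<sigma>. F (a # map f \<sigma>)) = z (\<lambda>\<sigma>. G (a # map f \<sigma>))"
      if "\<forall>\<sigma>. length \<sigma> = Suc k \<longrightarrow> set \<sigma> \<in> L \<longrightarrow> F \<sigma> = G \<sigma>" for F G
      by (rule chain_cong[OF z]) (use that L in simp)
  qed (simp add: chain_addD[OF z])
  show "z (\<lambda>\<sigma>. coboundary F (a # map f \<sigma>)) = z (\<lambda>\<sigma>. F (map f \<sigma>))" for F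
    using cycle[of "\<lambda>\<rho>. F (a # map f \<rho>)"]
    by (simp add: chain_addD[OF z] coboundary_map[of "\<lambda>\<rho>. F (a # \<rho>)"])
qed

section \<open>Towers of hemispheres\<close>

text \<open>
  The chains of a tower are the hemispheres in the usual cell structure of a sphere: the boundary
  of the last one is the sum of the previous one and of its antipode.
\<close>

inductive tower :: "'v set set \<Rightarrow> ('v \<Rightarrow> 'v) \<Rightarrow> nat \<Rightarrow> (('v list \<Rightarrow> bit) \<Rightarrow> bit) \<Rightarrow> bool"
  for K \<tau> where
  point: "{v} \<in> K \<Longrightarrow> tower K \<tau> 1 (\<lambda>F. F [v])"
| hemisphere: "tower K \<tau> k c \<Longrightarrow> chain K (Suc k) d \<Longrightarrow>
    (\<And>F. d (coboundary F) = c F + c (\<lambda>\<sigma>. F (map \<tau> \<sigma>))) \<Longrightarrow> tower K \<tau> (Suc k) d"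

lemma tower_chain: "tower K \<tau> k c \<Longrightarrow> chain K k c"
  by (induction rule: tower.induct) (simp_all add: chain_single)

text \<open>The boundary of a hemisphere is a chain plus its antipode, hence invariant under the
  involution \<open>\<tau>\<close>, so that hemisphere and antipode close up to a sphere. For a
  point, both boundaries are the empty list.\<close>

lemma tower_cycle:
  assumes "tower K \<tau> k c" and inv: "\<And>A v. A \<in> K \<Longrightarrow> v \<in> A \<Longrightarrow> \<tau> (\<tau> v) = v"
  shows "c (coboundary F) + c (\<lambda>\<sigma>. coboundary F (map \<tau> \<sigma>)) = 0"
  using assms(1)
proof cases
  case (hemisphere k c')
  have "c' (\<lambda>\<sigma>. F (map \<tau> (map \<tau> \<sigma>))) = c' F"
    by (rule chain_cong[OF tower_chain[OF hemisphere(2)]], rule arg_cong[of _ _ F])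
      (use inv in \<open>auto intro: map_idI\<close>)
  then show ?thesis
    using hemisphere(4)[of F] hemisphere(4)[of "\<lambda>\<sigma>. F (map \<tau> \<sigma>)"]
    by (simp add: coboundary_map o_def ac_simps)
qed simp

lemma tower_map:
  assumes "tower K \<tau> k c" and f: "\<And>A. A \<in> K \<Longrightarrow> f ` A \<in> L"
    and eq: "\<And>A v. A \<in> K \<Longrightarrow> v \<in> A \<Longrightarrow> f (\<tau> v) = \<upsilon> (f v)"
  shows "tower L \<upsilon> k (\<lambda>F. c (\<lambda>\<sigma>. F (map f \<sigma>)))"
  using assms(1)
proof (induction rule: tower.induct)
  case (point v)
  then show ?case using tower.point[of "f v" L \<upsilon>] f[of "{v}"] by simp
next
  case (hemisphere k c d)
  have "c (\<lambda>\<sigma>. F (map f (map \<tau> \<sigma>))) = c (\<lambda>\<sigma>. F (map \<upsilon> (map f \<sigma>)))" for F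
    by (rule chain_cong[OF tower_chain[OF hemisphere(1)]], rule arg_cong[of _ _ F])
      (use eq in auto)
  then have "d (\<lambda>\<sigma>. coboundary F (map f \<sigma>)) =
      c (\<lambda>\<sigma>. F (map f \<sigma>)) + c (\<lambda>\<sigma>. F (map \<upsilon> (map f \<sigma>)))" for F
    using hemisphere(3)[of "\<lambda>\<sigma>. F (map f \<sigma>)"] by (simp add: coboundary_map del: map_map)
  with hemisphere show ?case
    by (intro tower.hemisphere[OF hemisphere(4)] chain_map[OF _ f]) (simp_all del: map_map)
qed

text \<open>The map \<open>f\<close> places the sphere made of \<open>c\<close> and its antipode as
  an equator in \<open>L\<close>. A homology from \<open>f\<close> to \<open>g\<close> together with
  a cone over the image under \<open>g\<close> fills it and is the next hemisphere.\<close>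

lemma tower_suspension:
  assumes c: "tower K \<tau> k c" and inv: "\<And>A v. A \<in> K \<Longrightarrow> v \<in> A \<Longrightarrow> \<tau> (\<tau> v) = v"
    and K: "\<And>A. A \<in> K \<Longrightarrow> \<tau> ` A \<in> K"
    and f: "\<And>A. A \<in> K \<Longrightarrow> f ` A \<in> L"
    and eq: "\<And>A v. A \<in> K \<Longrightarrow> v \<in> A \<Longrightarrow> f (\<tau> v) = \<upsilon> (f v)"
    and hom: "\<And>z. chain K k z \<Longrightarrow> (\<And>F. z (coboundary F) = 0) \<Longrightarrow> homologous L k z f g"
    and cone: "\<And>A. A \<in> K \<Longrightarrow> insert a (g ` A) \<in> L"
  shows "\<exists>d. tower L \<upsilon> (Suc k) d"
proof -
  define z where "z F = c F + c (\<lambda>\<sigma>. F (map \<tau> \<sigma>))" for F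
  have ch: "chain K k z"
    unfolding z_def by (rule chain_add[OF tower_chain[OF c] chain_map[OF tower_chain[OF c] K]])
  have cycle: "z (coboundary F) = 0" for F
    unfolding z_def by (rule tower_cycle[OF c inv])
  obtain h1 where h1: "chain L (Suc k) h1"
    "\<And>F. h1 (coboundary F) = z (\<lambda>\<sigma>. F (map f \<sigma>)) + z (\<lambda>\<sigma>. F (map g \<sigma>))"
    using hom[OF ch cycle] unfolding homologous_def by blast
  obtain h2 where h2: "chain L (Suc k) h2" "\<And>F. h2 (coboundary F) = z (\<lambda>\<sigma>. F (map g \<sigma>))"
    using cone_bounds[OF ch cycle cone] by blast
  have "z (\<lambda>\<sigma>. F (map f \<sigma>)) = c (\<lambda>\<sigma>. F (map f \<sigma>)) + c (\<lambda>\<sigma>. F (map f (map \<tau> \<sigma>)))" for F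
    by (simp add: z_def)
  moreover have "c (\<lambda>\<sigma>. F (map f (map \<tau> \<sigma>))) = c (\<lambda>\<sigma>. F (map \<upsilon> (map f \<sigma>)))" for F
    by (rule chain_cong[OF tower_chain[OF c]], rule arg_cong[of _ _ F]) (use eq in auto)
  ultimately have "h1 (coboundary F) + h2 (coboundary F) =
      c (\<lambda>\<sigma>. F (map f \<sigma>)) + c (\<lambda>\<sigma>. F (map \<upsilon> (map f \<sigma>)))" for F
    by (simp add: h1(2) h2(2) ac_simps)
  then have "tower L \<upsilon> (Suc k) (\<lambda>F. h1 F + h2 F)"
    by (intro tower.hemisphere[OF tower_map[where f=f, OF c f eq]] chain_add[OF h1(1) h2(1)])
  then show ?thesis by blast
qed

section \<open>Fan's lemma\<close>

fun alternating :: "bool \<Rightarrow> bool list \<Rightarrow> bool" where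
  "alternating b [] \<longleftrightarrow> True"
| "alternating b (x # w) \<longleftrightarrow> x = b \<and> alternating (\<not> b) w"

lemma alternating_map_Not: "alternating b (map Not w) \<longleftrightarrow> alternating (\<not> b) w"
  by (induction w arbitrary: b) auto

text \<open>If \<open>w\<close> does not alternate but some deletion does, then \<open>w\<close> has
  exactly one pair of equal neighbours, and the two deletions there cancel. In a nonempty
  alternating word only the deletion of an end alternates: dropping the last entry keeps the first
  sign, dropping the first flips it.\<close>

lemma coboundary_alternating:
  "coboundary (\<lambda>w. of_bool (alternating b w)) w =
    of_bool (alternating b w) + of_bool (alternating (\<not> b) w)"
proof (induction w arbitrary: b)
  case (Cons x w)
  show ?case
  proof (cases "x = b")
    case True
    then have "(\<lambda>\<rho>. of_bool (alternating b (x # \<rho>))) = (\<lambda>\<rho>. of_bool (alternating (\<not> b) \<rho>) :: bit)"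
      by simp
    then show ?thesis using Cons.IH[of "\<not> b"] True by simp
  next
    case False
    then have "x = (\<not> b)" "(\<lambda>\<rho>. of_bool (alternating b (x # \<rho>))) = (\<lambda>\<rho>. 0 :: bit)"
      by auto
    then show ?thesis by simp
  qed
qed simp

lemma coboundary_mset:
  "coboundary (\<lambda>\<rho>. F (mset \<rho>)) \<sigma> = (\<Sum>v\<in>#mset \<sigma>. F (mset \<sigma> - {#v#}))"
proof (induction \<sigma> arbitrary: F)
  case (Cons v \<sigma>)
  have "(\<Sum>w\<in>#mset \<sigma>. F (add_mset v (mset \<sigma> - {#w#}))) =
      (\<Sum>w\<in>#mset \<sigma>. F (add_mset v (mset \<sigma>) - {#w#}))"
    by (rule arg_cong[of _ _ sum_mset], rule image_mset_cong) simp
  then show ?case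
    using Cons.IH[of "\<lambda>M. F (add_mset v M)"] by simp
qed simp

text \<open>\<open>F (sort \<rho>)\<close> depends only on the multiset of entries, so its
  coboundary may be computed on the sorted list, whose sublists are sorted again.\<close>

lemma coboundary_sort: "coboundary (\<lambda>\<rho>. F (sort \<rho>)) = (\<lambda>\<sigma>. coboundary F (sort \<sigma>))"
proof
  fix \<sigma>
  have "coboundary (\<lambda>\<rho>. F (sort \<rho>)) \<sigma> =
      coboundary (\<lambda>\<rho>. F (sorted_list_of_multiset (mset \<rho>))) \<sigma>"
    by simp
  also have "\<dots> = coboundary (\<lambda>\<rho>. F (sorted_list_of_multiset (mset \<rho>))) (sort \<sigma>)"
    by (simp only: coboundary_mset[of "\<lambda>M. F (sorted_list_of_multiset M)"] mset_sort)
  also have "\<dots> = coboundary F (sort \<sigma>)"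
  proof (rule coboundary_cong)
    fix \<rho> assume "subseq \<rho> (sort \<sigma>)"
    then obtain N where "\<rho> = nths (sort \<sigma>) N" by (auto simp: subseq_conv_nths)
    then have "sorted \<rho>" by (simp add: sorted_nths)
    then show "F (sorted_list_of_multiset (mset \<rho>)) = F \<rho>" by (simp add: sorted_sort_id)
  qed
  finally show "coboundary (\<lambda>\<rho>. F (sort \<rho>)) \<sigma> = coboundary F (sort \<sigma>)" .
qed

lemma sort_map_mono_on: "mono_on (set xs) f \<Longrightarrow> sort (map f xs) = map f (sort xs)"
  by (rule properties_for_sort)
    (auto simp: sorted_map dest: mono_onD intro!: sorted_wrt_mono_rel[OF _ sorted_sort[of xs]])

text \<open>The label of the colour \<open>i\<close> is \<open>2 * i\<close> or \<open>2 * i + 1\<close>, according to the sign.\<close>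

definition opposite :: "nat \<Rightarrow> nat" where
  "opposite l = (if even l then l + 1 else l - 1)"

lemma opposite_div [simp]: "opposite l div 2 = l div 2"
  by (auto simp: opposite_def elim!: oddE)

lemma odd_opposite [simp]: "odd (opposite l) \<longleftrightarrow> even l"
  by (auto simp: opposite_def)

text \<open>Without opposite pairs the swap of labels is monotone, so it commutes with sorting and
  flips every sign.\<close>

lemma alternating_sort_opposite:
  assumes "\<And>l. l \<in> set ls \<Longrightarrow> opposite l \<notin> set ls"
  shows "alternating b (map odd (sort (map opposite ls))) \<longleftrightarrow>
    alternating (\<not> b) (map odd (sort ls))"
proof -
  have "mono_on (set ls) opposite"
  proof (rule mono_onI)
    fix l m assume "l \<in> set ls" "m \<in> set ls" "l \<le> m"
    moreover from this assms have "m \<noteq> opposite l" by blast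
    ultimately show "opposite l \<le> opposite m"
      by (auto simp: opposite_def elim!: evenE oddE)
  qed
  then have "map odd (sort (map opposite ls)) = map Not (map odd (sort ls))"
    by (simp add: sort_map_mono_on)
  then show ?thesis by (simp only: alternating_map_Not)
qed

text \<open>Labels of the same colour are equal, as opposite ones are excluded; equal labels become
  neighbours in the sorted list and break the alternation.\<close>

lemma alternating_distinct:
  assumes "sorted ls" "alternating b (map odd ls)" "\<And>l. l \<in> set ls \<Longrightarrow> opposite l \<notin> set ls"
  shows "distinct (map (\<lambda>l. l div 2) ls)"
  using assms
proof (induction ls arbitrary: b)
  case (Cons l ls)
  have "l div 2 \<noteq> m div 2" if m: "m \<in> set ls" for m
  proof
    assume eq: "l div 2 = m div 2"
    have "m = l"
    proof (rule ccontr)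
      assume "m \<noteq> l"
      with eq have "m = opposite l"
        by (auto simp: opposite_def elim!: evenE oddE)
      then show False using Cons.prems(3)[of l] m by simp
    qed
    obtain x ls' where ls: "ls = x # ls'" using m by (cases ls) auto
    then have "l \<le> x" "x \<le> m" using Cons.prems(1) m by auto
    with \<open>m = l\<close> have "x = l" by simp
    then show False using Cons.prems(2) ls by auto
  qed
  then show ?case using Cons by fastforce
qed simp

text \<open>
  The statement counts modulo 2 the simplices of the last chain whose signs alternate when they are
  sorted by colour.
\<close>

lemma fan:
  assumes "tower K \<tau> k c"
    and label: "\<And>A v. A \<in> K \<Longrightarrow> v \<in> A \<Longrightarrow> label (\<tau> v) = opposite (label v)"
    and no: "\<And>A v w. A \<in> K \<Longrightarrow> v \<in> A \<Longrightarrow> w \<in> A \<Longrightarrow> label w \<noteq> opposite (label v)"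
  shows "c (\<lambda>\<sigma>. of_bool (alternating True (map odd (sort (map label \<sigma>))))) +
    c (\<lambda>\<sigma>. of_bool (alternating False (map odd (sort (map label \<sigma>))))) = 1"
  using assms(1)
proof (induction rule: tower.induct)
  case (hemisphere k c d)
  let ?F = "\<lambda>b \<sigma>. of_bool (alternating b (map odd (sort (map label \<sigma>)))) :: bit"
  have cob: "coboundary (?F True) = (\<lambda>\<sigma>. ?F True \<sigma> + ?F False \<sigma>)"
    using coboundary_map[of "\<lambda>\<rho>. of_bool (alternating True (map odd (sort \<rho>)))" label]
      coboundary_sort[of "\<lambda>\<rho>. of_bool (alternating True (map odd (\<rho> :: nat list)))"]
      coboundary_map[of "\<lambda>\<rho>. of_bool (alternating True \<rho>)" "odd :: nat \<Rightarrow> bool"]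
    by (simp add: coboundary_alternating)
  \<comment> \<open>The antipode exchanges the two alternation types, so the total count for
    \<open>d\<close> equals that for \<open>c\<close>, and its parity passes up the tower.\<close>
  have "c (\<lambda>\<sigma>. ?F True (map \<tau> \<sigma>)) = c (?F False)"
  proof (rule chain_cong[OF tower_chain[OF hemisphere(1)]])
    fix \<sigma> assume \<sigma>: "set \<sigma> \<in> K"
    have eq: "map label (map \<tau> \<sigma>) = map opposite (map label \<sigma>)"
      using label[OF \<sigma>] by simp
    have "opposite l \<notin> set (map label \<sigma>)" if "l \<in> set (map label \<sigma>)" for l
      using no[OF \<sigma>] that by force
    then show "?F True (map \<tau> \<sigma>) = ?F False \<sigma>"
      unfolding eq by (subst alternating_sort_opposite) simp_all
  qed
  moreover have "d (?F True) + d (?F False) = d (coboundary (?F True))"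
    unfolding cob by (rule chain_addD[OF hemisphere(2), symmetric])
  ultimately show ?case
    using hemisphere(3)[of "?F True"] hemisphere(4) by simp
qed simp

text \<open>By \<open>fan\<close> the alternating simplices are odd in number, so there is one; its
  \<open>k\<close> labels have distinct colours.\<close>

lemma tower_colour_bound:
  assumes tower: "tower K \<tau> k c"
    and label: "\<And>A v. A \<in> K \<Longrightarrow> v \<in> A \<Longrightarrow> label (\<tau> v) = opposite (label v)"
    and no: "\<And>A v w. A \<in> K \<Longrightarrow> v \<in> A \<Longrightarrow> w \<in> A \<Longrightarrow> label w \<noteq> opposite (label v)"
    and col: "\<And>A v. A \<in> K \<Longrightarrow> v \<in> A \<Longrightarrow> label v div 2 \<in> C" and "finite C"
  shows "k \<le> card C"
proof -
  let ?F = "\<lambda>b \<sigma>. of_bool (alternating b (map odd (sort (map label \<sigma>)))) :: bit"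
  have ch: "chain K k c" by (rule tower_chain[OF tower])
  have "\<exists>\<sigma> b. length \<sigma> = k \<and> set \<sigma> \<in> K \<and> alternating b (map odd (sort (map label \<sigma>)))"
  proof (rule ccontr)
    assume none: "\<not> ?thesis"
    have "c (?F b) = c (\<lambda>_. 0)" for b
      by (rule chain_cong[OF ch]) (use none in auto)
    then show False using fan[where label = label, OF tower label no] by (simp add: chain_zero[OF ch])
  qed
  then obtain \<sigma> b where \<sigma>: "length \<sigma> = k" "set \<sigma> \<in> K"
    "alternating b (map odd (sort (map label \<sigma>)))" by blast
  let ?ls = "sort (map label \<sigma>)"
  have "opposite l \<notin> set ?ls" if "l \<in> set ?ls" for l
    using no[OF \<sigma>(2)] that by force
  then have "distinct (map (\<lambda>l. l div 2) ?ls)"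
    using \<sigma>(3) by (intro alternating_distinct) auto
  then have "card (set (map (\<lambda>l. l div 2) ?ls)) = k"
    using distinct_card \<sigma>(1) by fastforce
  moreover have "set (map (\<lambda>l. l div 2) ?ls) \<subseteq> C" using col[OF \<sigma>(2)] by auto
  ultimately show ?thesis using card_mono[OF \<open>finite C\<close>] by metis
qed

section \<open>The chromatic number of W(s,t)\<close>

definition near :: "nat \<Rightarrow> nat \<Rightarrow> bool" where
  "near a b \<longleftrightarrow> a = Suc b \<or> b = Suc a"

text \<open>
  A vertex \<open>x\<close> of \<open>W(s,t)\<close> with a sign \<open>p\<close> is encoded by the sequence \<open>u\<close> in which every \<open>u\<^sub>i\<close> is
  the member of \<open>{x\<^sub>i, N - x\<^sub>i}\<close> which is odd if \<open>p\<close> holds and even otherwise, where \<open>N = 2 * s + 1\<close>.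
  Two vertices of opposite signs are adjacent if their entries differ by 1 everywhere: this includes
  the case \<open>x\<^sub>i = y\<^sub>i = s\<close>, because \<open>N - s = s + 1\<close>.
\<close>

definition cover_vertex :: "nat \<Rightarrow> nat \<Rightarrow> bool \<Rightarrow> nat list \<Rightarrow> bool" where
  "cover_vertex N t p u \<longleftrightarrow> length u = t \<and> (\<forall>a\<in>set u. a \<le> N \<and> odd a = p) \<and>
     count_list u (if p then N else 0) = 1 \<and> (if p then 1 else N - 1) \<in> set u"

text \<open>A box complex: if one side is empty, the other may be any set of vertices, with or
  without a common neighbour.\<close>

definition cover :: "nat \<Rightarrow> nat \<Rightarrow> (bool \<times> nat list) set set" where
  "cover N t = {A. (\<forall>p u. (p, u) \<in> A \<longrightarrow> cover_vertex N t p u) \<and>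
     (\<forall>u v. (True, u) \<in> A \<longrightarrow> (False, v) \<in> A \<longrightarrow> list_all2 near u v)}"

definition antipode :: "nat \<Rightarrow> bool \<times> nat list \<Rightarrow> bool \<times> nat list" where
  "antipode N = (\<lambda>(p, u). (\<not> p, map (\<lambda>a. N - a) u))"

lemma count_list_map:
  assumes "\<And>a. a \<in> set u \<Longrightarrow> f a = y \<longleftrightarrow> a = x"
  shows "count_list (map f u) y = count_list u x"
  using assms by (induction u) auto

lemma cover_subset: "B \<in> cover N t \<Longrightarrow> A \<subseteq> B \<Longrightarrow> A \<in> cover N t"
  unfolding cover_def by blast

lemma coverD:
  assumes "A \<in> cover N t"
  shows "(p, u) \<in> A \<Longrightarrow> cover_vertex N t p u"
    and "(True, u) \<in> A \<Longrightarrow> (False, v) \<in> A \<Longrightarrow> list_all2 near u v"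
  using assms unfolding cover_def by blast+

lemma antipode_antipode:
  assumes "A \<in> cover N t" "v \<in> A"
  shows "antipode N (antipode N v) = v"
proof -
  obtain p u where v: "v = (p, u)" by force
  then have "\<forall>a\<in>set u. a \<le> N" using coverD(1)[OF assms(1)] assms(2) by (simp add: cover_vertex_def)
  then show ?thesis by (auto simp: v antipode_def o_def intro: map_idI)
qed

lemma cover_vertex_antipode:
  assumes "odd N" "cover_vertex N t p u"
  shows "cover_vertex N t (\<not> p) (map (\<lambda>a. N - a) u)"
proof -
  from assms(2) have u: "length u = t" "\<And>a. a \<in> set u \<Longrightarrow> a \<le> N \<and> odd a = p"
    "count_list u (if p then N else 0) = 1" "(if p then 1 else N - 1) \<in> set u"
    by (simp_all add: cover_vertex_def)
  have "count_list (map (\<lambda>a. N - a) u) (if \<not> p then N else 0) = count_list u (if p then N else 0)"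
    by (rule count_list_map) (use u(2) assms(1) in fastforce)
  moreover have "(if \<not> p then 1 else N - 1) \<in> set (map (\<lambda>a. N - a) u)"
    using u(4) assms(1) by (auto simp: image_iff intro!: bexI[of _ "if p then 1 else N - 1"] elim: oddE)
  moreover have "\<forall>b\<in>set (map (\<lambda>a. N - a) u). b \<le> N \<and> odd b = (\<not> p)"
  proof
    fix b assume "b \<in> set (map (\<lambda>a. N - a) u)"
    then obtain a where "a \<in> set u" "b = N - a" by auto
    then show "b \<le> N \<and> odd b = (\<not> p)" using u(2)[of a] assms(1) by simp
  qed
  ultimately show ?thesis
    unfolding cover_vertex_def using u(1,3) by (simp only: length_map)
qed

lemma cover_antipode:
  assumes "odd N" "A \<in> cover N t"
  shows "antipode N ` A \<in> cover N t"
  unfolding cover_def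
proof (rule CollectI, intro conjI allI impI)
  show "cover_vertex N t p u" if "(p, u) \<in> antipode N ` A" for p u
    using that cover_vertex_antipode[OF assms(1) coverD(1)[OF assms(2)]] by (auto simp: antipode_def)
  fix u v assume "(True, u) \<in> antipode N ` A" "(False, v) \<in> antipode N ` A"
  then obtain u' v' where uv: "(True, v') \<in> A" "(False, u') \<in> A"
    "u = map (\<lambda>a. N - a) u'" "v = map (\<lambda>a. N - a) v'"
    unfolding antipode_def by force
  have "list_all2 near v' u'" "\<forall>a\<in>set v'. a \<le> N" "\<forall>a\<in>set u'. a \<le> N"
    using coverD[OF assms(2)] uv(1,2) by (auto simp: cover_vertex_def)
  then have "list_all2 (\<lambda>a b. near (N - b) (N - a)) v' u'"
    by (elim list.rel_mono_strong) (auto simp: near_def)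
  then show "list_all2 near u v"
    unfolding uv(3,4) list_all2_map1 list_all2_map2
    by (metis (mono_tags, lifting) list_all2_conv_all_nth)
qed

section \<open>Contraction of the equator within a hemisphere\<close>

definition level :: "nat \<Rightarrow> bool \<Rightarrow> nat" where
  "level k p = (if odd k = p then k else Suc k)"

text \<open>For \<open>N = 2 * s + 1\<close> both \<open>s\<close> and \<open>s + 1\<close> encode
  the entry \<open>s\<close>, so \<open>raise s\<close> is the inclusion of the equator; other
  values of \<open>k\<close> displace it.\<close>

definition raise :: "nat \<Rightarrow> bool \<times> nat list \<Rightarrow> bool \<times> nat list" where
  "raise k = (\<lambda>(p, u). (p, level k p # u))"

definition squeeze :: "nat \<Rightarrow> nat \<Rightarrow> bool \<times> nat list \<Rightarrow> bool \<times> nat list" where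
  "squeeze N k = (\<lambda>(p, u). (p, level (N - 1) p # map (\<lambda>a. min a (level k p)) u))"

lemma even_level [simp]: "even (level k p) \<longleftrightarrow> \<not> p"
  by (cases p) (simp_all add: level_def)

lemma near_level:
  "k = l \<or> k = Suc l \<or> l = Suc k \<Longrightarrow> near (level k True) (level l False)"
  by (auto simp: near_def level_def)

text \<open>If just one of \<open>a\<close> and \<open>b\<close> exceeds its cap, the parities force
  the other to equal its own cap.\<close>

lemma near_min:
  assumes "near a b" "near l m" "odd a = odd l"
  shows "near (min a l) (min b m)"
  using assms unfolding near_def min_def by (auto; presburger)

lemma cover_vertex_raise:
  assumes "1 \<le> k" "k + 2 \<le> N" "odd N" "cover_vertex N t p u"
  shows "cover_vertex N (Suc t) p (level k p # u)"
proof -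
  have "level k p \<noteq> (if p then N else 0)" "level k p \<le> N"
    using assms(1-3) by (auto simp: level_def)
  then show ?thesis using assms(4) by (auto simp: cover_vertex_def)
qed

text \<open>For sign \<open>True\<close> the cap removes the old zero, encoded by \<open>N\<close>,
  and the head is the new one; for \<open>False\<close> the old zero survives and the head
  \<open>N - 1\<close> encodes the required entry 1.\<close>

lemma cover_vertex_squeeze:
  assumes "1 \<le> k" "k + 2 \<le> N" "odd N" "cover_vertex N t p u"
  shows "cover_vertex N (Suc t) p (level (N - 1) p # map (\<lambda>a. min a (level k p)) u)"
proof (cases p)
  case True
  have u: "\<And>a. a \<in> set u \<Longrightarrow> odd a" "1 \<in> set u" "length u = t"
    using assms(4) True by (auto simp: cover_vertex_def)
  have l: "level k True < N" "1 \<le> level k True" "level (N - 1) True = N"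
    using assms(1-3) by (auto simp: level_def)
  have "count_list (map (\<lambda>a. min a (level k True)) u) N = 0"
    using l(1) by (auto simp: count_list_0_iff)
  moreover have "1 \<in> (\<lambda>a. min a (level k True)) ` set u"
    using u(2) l(2) by (auto simp: image_iff intro!: bexI[of _ 1])
  moreover have "odd (min a (level k True))" if "a \<in> set u" for a
    using u(1)[OF that] by (simp add: min_def)
  ultimately show ?thesis
    using True l u(3) assms(3) by (auto simp: cover_vertex_def min_le_iff_disj)
next
  case False
  have u: "\<And>a. a \<in> set u \<Longrightarrow> even a" "count_list u 0 = 1" "length u = t"
    using assms(4) False by (auto simp: cover_vertex_def)
  have l: "level k False < N" "1 \<le> level k False" "level (N - 1) False = N - 1"
    using assms(1-3) by (auto simp: level_def)
  have "count_list (map (\<lambda>a. min a (level k False)) u) 0 = count_list u 0"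
    by (rule count_list_map) (use l(2) in auto)
  moreover have "even (min a (level k False))" if "a \<in> set u" for a
    using u(1)[OF that] by (simp add: min_def)
  ultimately show ?thesis
    using False l u(2,3) assms(2,3) by (auto simp: cover_vertex_def min_le_iff_disj)
qed

lemma cover_union:
  assumes A: "A \<in> cover N t" and f: "f = (\<lambda>(p, u). (p, f' p u))" and g: "g = (\<lambda>(p, u). (p, g' p u))"
    and vertex: "\<And>p u. cover_vertex N t p u \<Longrightarrow> cover_vertex N (Suc t) p (f' p u)"
      "\<And>p u. cover_vertex N t p u \<Longrightarrow> cover_vertex N (Suc t) p (g' p u)"
    and near: "\<And>u v h h'. cover_vertex N t True u \<Longrightarrow> cover_vertex N t False v \<Longrightarrow>
      list_all2 near u v \<Longrightarrow> h = f' \<or> h = g' \<Longrightarrow> h' = f' \<or> h' = g' \<Longrightarrow>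
      list_all2 near (h True u) (h' False v)"
  shows "f ` A \<union> g ` A \<in> cover N (Suc t)"
  unfolding cover_def
proof (rule CollectI, intro conjI allI impI)
  show "cover_vertex N (Suc t) p u" if "(p, u) \<in> f ` A \<union> g ` A" for p u
    using that vertex coverD(1)[OF A] by (auto simp: f g)
  have preimage: "\<exists>x h. (q, x) \<in> A \<and> (h = f' \<or> h = g') \<and> w = h q x"
    if "(q, w) \<in> f ` A \<union> g ` A" for q w
    using that by (auto simp: f g)
  fix u v assume "(True, u) \<in> f ` A \<union> g ` A" "(False, v) \<in> f ` A \<union> g ` A"
  then obtain x y h h' where xy: "(True, x) \<in> A" "(False, y) \<in> A"
    and h: "h = f' \<or> h = g'" "h' = f' \<or> h' = g'" and uv: "u = h True x" "v = h' False y"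
    using preimage by metis
  show "list_all2 near u v"
    unfolding uv using coverD[OF A] xy by (intro near[OF _ _ _ h]) simp_all
qed

lemma cover_raise:
  assumes "1 \<le> k" "k \<le> l" "l \<le> Suc k" "l + 2 \<le> N" "odd N" "A \<in> cover N t"
  shows "raise k ` A \<union> raise l ` A \<in> cover N (Suc t)"
  using assms(6) raise_def raise_def
proof (rule cover_union)
  have kl: "l = k \<or> l = Suc k" using assms(2,3) by linarith
  then have nl: "near (level i True) (level j False)" if "i = k \<or> i = l" "j = k \<or> j = l" for i j
    using that by (intro near_level) auto
  show "list_all2 near (h True u) (h' False v)"
    if "list_all2 near u v" "h = (\<lambda>p u. level k p # u) \<or> h = (\<lambda>p u. level l p # u)"
      "h' = (\<lambda>p u. level k p # u) \<or> h' = (\<lambda>p u. level l p # u)" for u v h h'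
    using that by (elim disjE) (simp_all add: nl)
  show "cover_vertex N (Suc t) p (level k p # u)" "cover_vertex N (Suc t) p (level l p # u)"
    if "cover_vertex N t p u" for p u
    using assms(1-5) that by (intro cover_vertex_raise; simp)+
qed

lemma list_all2_near_squeeze:
  assumes "list_all2 near u v" "\<forall>a\<in>set u. odd a" "k = l \<or> k = Suc l \<or> l = Suc k"
  shows "list_all2 near (map (\<lambda>a. min a (level k True)) u) (map (\<lambda>a. min a (level l False)) v)"
  unfolding list_all2_map1 list_all2_map2
  using assms(1)
proof (rule list.rel_mono_strong)
  fix a b assume "a \<in> set u" "near a b"
  then show "near (min a (level k True)) (min b (level l False))"
    using assms(2,3) by (intro near_min near_level) simp_all
qed

lemma cover_squeeze:
  assumes "1 \<le> k" "k \<le> l" "l \<le> Suc k" "l + 2 \<le> N" "odd N" "A \<in> cover N t"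
  shows "squeeze N k ` A \<union> squeeze N l ` A \<in> cover N (Suc t)"
  using assms(6) squeeze_def squeeze_def
proof (rule cover_union)
  let ?h = "\<lambda>k p u. level (N - 1) p # map (\<lambda>a. min a (level k p)) u"
  have kl: "l = k \<or> l = Suc k" using assms(2,3) by linarith
  show "list_all2 near (h True u) (h' False v)"
    if "cover_vertex N t True u" "list_all2 near u v" "h = ?h k \<or> h = ?h l" "h' = ?h k \<or> h' = ?h l"
    for u v h h'
  proof -
    have "\<forall>a\<in>set u. odd a" using that(1) by (simp add: cover_vertex_def)
    then have sq: "list_all2 near (?h i True u) (?h j False v)" if "i = k \<or> i = l" "j = k \<or> j = l" for i j
      using that kl \<open>list_all2 near u v\<close> by (auto intro!: list_all2_near_squeeze near_level)
    then show ?thesis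
      using \<open>h = ?h k \<or> h = ?h l\<close> \<open>h' = ?h k \<or> h' = ?h l\<close> by (elim disjE) (simp_all only: simp_thms)
  qed
  show "cover_vertex N (Suc t) p (?h k p u)" "cover_vertex N (Suc t) p (?h l p u)"
    if "cover_vertex N t p u" for p u
    using assms(1-5) that by (intro cover_vertex_squeeze; simp)+
qed

text \<open>On sign \<open>False\<close> both maps agree: the head is \<open>N - 1\<close>, and a
  cap at \<open>N - 1\<close> leaves even entries unchanged. On sign \<open>True\<close> the heads
  \<open>N - 2\<close> and \<open>N\<close> are both near \<open>N - 1\<close>.\<close>

lemma cover_raise_squeeze:
  assumes "3 \<le> N" "odd N" "A \<in> cover N t"
  shows "raise (N - 2) ` A \<union> squeeze N (N - 2) ` A \<in> cover N (Suc t)"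
  using assms(3) raise_def squeeze_def
proof (rule cover_union)
  let ?f = "\<lambda>p u. level (N - 2) p # u"
  let ?g = "\<lambda>p u. level (N - 1) p # map (\<lambda>a. min a (level (N - 2) p)) u"
  show "list_all2 near (h True u) (h' False v)"
    if u: "cover_vertex N t True u" and v: "cover_vertex N t False v" and uv: "list_all2 near u v"
      and h: "h = ?f \<or> h = ?g" "h' = ?f \<or> h' = ?g" for u v h h'
  proof -
    have l: "level (N - 2) False = N - 1" "level (N - 1) False = N - 1"
      "level (N - 2) True = N - 2" "level (N - 1) True = N"
      using assms(1,2) by (auto simp: level_def)
    have "map (\<lambda>a. min a (N - 1)) v = v"
    proof (rule map_idI)
      fix a assume "a \<in> set v"
      then have "a \<le> N" "even a" using v by (auto simp: cover_vertex_def)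
      moreover from \<open>even a\<close> assms(2) have "a \<noteq> N" by auto
      ultimately show "min a (N - 1) = a" by simp
    qed
    then have "?g False v = (N - 1) # v" "?f False v = (N - 1) # v"
      by (simp_all only: l \<open>map (\<lambda>a. min a (N - 1)) v = v\<close>)
    then have h': "h' False v = (N - 1) # v" using h(2) by blast
    have "\<forall>a\<in>set u. odd a" using u by (simp add: cover_vertex_def)
    then have "list_all2 near (map (\<lambda>a. min a (level (N - 2) True)) u)
        (map (\<lambda>a. min a (level (N - 2) False)) v)"
      using uv by (intro list_all2_near_squeeze) simp_all
    then have "list_all2 near (map (\<lambda>a. min a (N - 2)) u) v"
      by (simp only: l \<open>map (\<lambda>a. min a (N - 1)) v = v\<close>)
    moreover have "near (N - 2) (N - 1)" "near N (N - 1)"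
      using assms(1) by (auto simp: near_def)
    ultimately show ?thesis
      using h(1) uv by (elim disjE) (simp_all only: h' l list_all2_Cons simp_thms)
  qed
  show "cover_vertex N (Suc t) p (?f p u)" "cover_vertex N (Suc t) p (?g p u)"
    if "cover_vertex N t p u" for p u
    using assms(1,2) that by (intro cover_vertex_raise cover_vertex_squeeze; simp)+
qed

text \<open>A chain of contiguous maps: lift the new entry from \<open>k\<close> to
  \<open>N - 2\<close>, move it to the top, then lower the cap on the old entries from
  \<open>N - 2\<close> to 1.\<close>

lemma raise_squeeze_homologous:
  assumes N: "odd N" "3 \<le> N" and k: "1 \<le> k" "k + 2 \<le> N"
    and z: "chain (cover N t) m z" "\<And>F. z (coboundary F) = 0"
  shows "homologous (cover N (Suc t)) m z (raise k) (squeeze N 1)"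
proof -
  have step: "homologous (cover N (Suc t)) m z f g"
    if "\<And>A. A \<in> cover N t \<Longrightarrow> f ` A \<union> g ` A \<in> cover N (Suc t)" for f g
    by (rule contiguous_homologous[OF z]) (use that cover_subset in blast)+
  have "homologous (cover N (Suc t)) m z (raise k) (raise (N - 2))"
  proof (rule inc_induct[of k "N - 2"])
    show "homologous (cover N (Suc t)) m z (raise (N - 2)) (raise (N - 2))"
      by (rule step, rule cover_raise) (use N in simp_all)
    fix l assume l: "k \<le> l" "l < N - 2"
      and hom: "homologous (cover N (Suc t)) m z (raise (Suc l)) (raise (N - 2))"
    show "homologous (cover N (Suc t)) m z (raise l) (raise (N - 2))"
      by (rule homologous_trans[OF step hom], rule cover_raise) (use N k l in simp_all)
  qed (use k in simp)
  moreover have "homologous (cover N (Suc t)) m z (raise (N - 2)) (squeeze N (N - 2))"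
    by (rule step, rule cover_raise_squeeze) (use N in simp_all)
  moreover have "homologous (cover N (Suc t)) m z (squeeze N (N - 2)) (squeeze N 1)"
  proof (rule dec_induct[of 1 "N - 2"])
    show "homologous (cover N (Suc t)) m z (squeeze N 1) (squeeze N 1)"
      by (rule step, rule cover_squeeze) (use N in simp_all)
    fix l assume l: "1 \<le> l" "l < N - 2"
      and hom: "homologous (cover N (Suc t)) m z (squeeze N l) (squeeze N 1)"
    have "squeeze N (Suc l) ` A \<union> squeeze N l ` A \<in> cover N (Suc t)" if "A \<in> cover N t" for A
      using cover_squeeze[OF l(1) _ _ _ N(1) that, of "Suc l"] l by (simp add: Un_commute)
    then show "homologous (cover N (Suc t)) m z (squeeze N (Suc l)) (squeeze N 1)"
      by (rule homologous_trans[OF step hom])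
  qed (use N in simp)
  ultimately show ?thesis by (blast intro: homologous_trans)
qed

text \<open>Under the lowest cap the old entries of sign \<open>False\<close> become 0 or 2, both
  near 1, so the apex is joined to all of these vertices.\<close>

lemma squeeze_cone:
  assumes N: "odd N" "3 \<le> N" and t: "1 \<le> t" and A: "A \<in> cover N t"
  shows "insert (True, N # replicate t 1) (squeeze N 1 ` A) \<in> cover N (Suc t)"
  unfolding cover_def
proof (rule CollectI, intro conjI allI impI)
  have sq: "squeeze N 1 ` A \<in> cover N (Suc t)"
    using cover_squeeze[of 1 1 N A t] N A by simp
  have "count_list (replicate t 1) N = 0" using N by (auto simp: count_list_0_iff)
  then have "cover_vertex N (Suc t) True (N # replicate t 1)"
    using N t by (auto simp: cover_vertex_def)
  then show "cover_vertex N (Suc t) p u"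
    if "(p, u) \<in> insert (True, N # replicate t 1) (squeeze N 1 ` A)" for p u
    using that coverD(1)[OF sq] by blast
  have apex: "list_all2 near (N # replicate t 1) v" if "(False, v) \<in> squeeze N 1 ` A" for v
  proof -
    obtain v' where v': "(False, v') \<in> A"
      "v = level (N - 1) False # map (\<lambda>a. min a (level 1 False)) v'"
      using \<open>(False, v) \<in> squeeze N 1 ` A\<close> by (auto simp: squeeze_def)
    have l: "level (N - 1) False = N - 1" "level 1 False = 2"
      using N by (simp_all add: level_def)
    have len: "length v' = t" and "\<forall>a\<in>set v'. even a"
      using coverD(1)[OF A v'(1)] by (auto simp: cover_vertex_def)
    moreover have "near 1 (min a 2)" if "even a" for a :: nat
      using that unfolding min_def near_def by presburger
    ultimately have "near 1 (min (v' ! i) 2)" if "i < t" for i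
      using that len nth_mem[of i v'] by simp
    then have "list_all2 near (replicate t 1) (map (\<lambda>a. min a 2) v')"
      using len by (auto simp: list_all2_conv_all_nth)
    moreover have "near N (N - 1)" using N by (simp add: near_def)
    ultimately show ?thesis unfolding v'(2) l by simp
  qed
  show "list_all2 near u v"
    if "(True, u) \<in> insert (True, N # replicate t 1) (squeeze N 1 ` A)"
      "(False, v) \<in> insert (True, N # replicate t 1) (squeeze N 1 ` A)" for u v
    using that apex coverD(2)[OF sq] by blast
qed

lemma tower_cover:
  assumes "2 \<le> t" "1 \<le> s"
  shows "\<exists>c. tower (cover (2 * s + 1) t) (antipode (2 * s + 1)) t c"
proof -
  define N where "N = 2 * s + 1"
  have N: "odd N" "3 \<le> N" using assms(2) by (auto simp: N_def)
  have "\<exists>c. tower (cover N t) (antipode N) t c"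
    using assms(1)
  proof (induction t rule: dec_induct)
    case base
    \<comment> \<open>These encode (0,1) and (1,0) with sign \<open>True\<close>, and (0,1) with
      sign \<open>False\<close>. The path through them is a half circle from \<open>?a\<close> to
      its antipode.\<close>
    let ?a = "(True, [N, 1])" and ?b = "(True, [1, N])" and ?a' = "(False, [0, N - 1])"
    have vertex: "cover_vertex N 2 True [N, 1]" "cover_vertex N 2 True [1, N]"
      "cover_vertex N 2 False [0, N - 1]"
      using N by (simp_all add: cover_vertex_def)
    have "list_all2 near [1, N] [0, N - 1]" using N by (simp add: near_def)
    then have K: "{?a, ?b} \<in> cover N 2" "{?b, ?a'} \<in> cover N 2"
      unfolding cover_def using vertex by blast+
    then have "{?a} \<in> cover N 2" using cover_subset by blast
    have 1: "tower (cover N 2) (antipode N) 1 (\<lambda>F. F [?a])"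
      by (rule tower.point) fact
    have "tower (cover N 2) (antipode N) (Suc 1) (\<lambda>F. F [?a, ?b] + F [?b, ?a'])"
      by (rule tower.hemisphere[OF 1 chain_add[OF chain_single chain_single]])
        (use K in \<open>simp_all add: antipode_def ac_simps\<close>)
    then show ?case by (auto simp: numeral_2_eq_2)
  next
    case (step t)
    then obtain c where c: "tower (cover N t) (antipode N) t c" by blast
    show ?case
    proof (rule tower_suspension[OF c, where f = "raise s" and g = "squeeze N 1"])
      show "raise s ` A \<in> cover N (Suc t)" if "A \<in> cover N t" for A
        using cover_raise[of s s N A t] that N assms(2) by (simp add: N_def)
      \<comment> \<open>Equivariance holds at the height \<open>s\<close>, since
        \<open>N - a\<close> exchanges \<open>s\<close> and \<open>s + 1\<close>.\<close>
      show "raise s (antipode N v) = antipode N (raise s v)" if "A \<in> cover N t" "v \<in> A" for A v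
        by (cases v) (auto simp: raise_def antipode_def level_def N_def)
      show "homologous (cover N (Suc t)) t z (raise s) (squeeze N 1)"
        if "chain (cover N t) t z" "\<And>F. z (coboundary F) = 0" for z
        by (rule raise_squeeze_homologous[OF N _ _ that]) (use assms(2) in \<open>auto simp: N_def\<close>)
      show "insert (True, N # replicate t 1) (squeeze N 1 ` A) \<in> cover N (Suc t)"
        if "A \<in> cover N t" for A
        by (rule squeeze_cone[OF N _ that]) (use step in simp)
    qed (rule antipode_antipode cover_antipode[OF N(1)]; assumption)+
  qed
  then show ?thesis by (simp add: N_def)
qed

section \<open>Projection of the double cover and proper colourings\<close>

definition fold_cover :: "nat \<Rightarrow> nat list \<Rightarrow> nat list" where
  "fold_cover N u = map (\<lambda>a. min a (N - a)) u"

lemma ex1_nth_iff_count_list: "(\<exists>!i. i < length x \<and> x ! i = a) \<longleftrightarrow> count_list x a = 1"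
proof -
  have "count_list x a = card {i. i < length x \<and> x ! i = a}"
    by (simp add: count_list_eq_length_filter length_filter_conv_card eq_commute[of a])
  then show ?thesis
    by (simp only: One_nat_def card_1_singleton_iff) (simp add: set_eq_iff Ex1_def, metis)
qed

lemma W_verts_iff:
  "x \<in> W_verts s t \<longleftrightarrow>
    length x = t \<and> (\<forall>a\<in>set x. a \<le> s) \<and> count_list x 0 = 1 \<and> 1 \<in> set x"
  unfolding W_verts_def mem_Collect_eq ex1_nth_iff_count_list[symmetric]
  by (cases "length x = t") (simp_all add: all_set_conv_all_nth in_set_conv_nth)

lemma fold_cover_W_verts:
  assumes "1 \<le> s" "cover_vertex (2 * s + 1) t p u"
  shows "fold_cover (2 * s + 1) u \<in> W_verts s t"
proof -
  let ?N = "2 * s + 1"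
  from assms(2) have u: "length u = t" "\<And>a. a \<in> set u \<Longrightarrow> a \<le> ?N" "\<And>a. a \<in> set u \<Longrightarrow> odd a = p"
    "count_list u (if p then ?N else 0) = 1" "(if p then 1 else ?N - 1) \<in> set u"
    unfolding cover_vertex_def by blast+
  have "count_list (fold_cover ?N u) 0 = count_list u (if p then ?N else 0)"
    unfolding fold_cover_def
  proof (rule count_list_map)
    fix a assume "a \<in> set u"
    then have "a \<le> ?N" "odd a = p" by (rule u)+
    moreover from this have "p \<Longrightarrow> a \<noteq> 0" "\<not> p \<Longrightarrow> a \<noteq> ?N"
      by (auto intro: odd_pos)
    ultimately show "min a (?N - a) = 0 \<longleftrightarrow> a = (if p then ?N else 0)"
      by (auto simp: min_def)
  qed
  moreover have "min (if p then 1 else ?N - 1) (?N - (if p then 1 else ?N - 1)) = 1"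
    using assms(1) by auto
  then have "1 \<in> set (fold_cover ?N u)"
    unfolding fold_cover_def set_map using u(5) by (intro image_eqI[OF _ u(5)]) (rule sym)
  moreover have "min a (?N - a) \<le> s" for a by linarith
  ultimately show ?thesis
    using u(1,4) by (simp add: W_verts_iff fold_cover_def)
qed

lemma fold_cover_adjacent:
  assumes "1 \<le> s" "cover_vertex (2 * s + 1) t p u" "cover_vertex (2 * s + 1) t q v"
    and "list_all2 near u v"
  shows "(fold_cover (2 * s + 1) u, fold_cover (2 * s + 1) v) \<in> parcs (W s t)"
  unfolding parcs_W_iff
proof (intro conjI allI impI)
  fix i assume i: "i < t"
  have len: "length u = t" "length v = t" using assms(2,3) by (simp_all add: cover_vertex_def)
  have "near (u ! i) (v ! i)" using assms(4) i len by (simp add: list_all2_conv_all_nth)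
  moreover have "u ! i \<le> 2 * s + 1" "v ! i \<le> 2 * s + 1"
    using assms(2,3) i len nth_mem[of i u] nth_mem[of i v] by (auto simp: cover_vertex_def)
  ultimately show "\<bar>int (fold_cover (2 * s + 1) u ! i) - int (fold_cover (2 * s + 1) v ! i)\<bar> = 1 \<or>
      fold_cover (2 * s + 1) u ! i = s \<and> fold_cover (2 * s + 1) v ! i = s"
    using i len unfolding near_def fold_cover_def by (simp only: nth_map, linarith)
qed (use fold_cover_W_verts assms in blast)+

text \<open>Antipodal vertices have the same projection and hence share a colour. Opposite labels
  inside a simplex would put one colour on both ends of an edge, so the counting argument applies to
  the pulled back colouring.\<close>

lemma coloring_lower_bound:
  assumes "2 \<le> t" "1 \<le> s" and c: "fold_coloring 1 n (W s t) c"
  shows "t \<le> n"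
proof -
  let ?N = "2 * s + 1"
  define col where "col u = the_elem (c (fold_cover ?N u))" for u
  define label where "label = (\<lambda>(p, u). 2 * col u + of_bool p)"
  have c_eq: "c (fold_cover ?N u) = {col u}" "col u \<in> {1..n}" if "cover_vertex ?N t p u" for p u
  proof -
    have "c (fold_cover ?N u) \<subseteq> {1..n}" "card (c (fold_cover ?N u)) = 1"
      using c fold_cover_W_verts[OF assms(2) that] by (auto simp: fold_coloring_def pverts_W)
    then show "c (fold_cover ?N u) = {col u}" "col u \<in> {1..n}"
      by (auto simp: col_def card_1_singleton_iff)
  qed
  obtain h where h: "tower (cover ?N t) (antipode ?N) t h"
    using tower_cover[OF assms(1,2)] by blast
  have "t \<le> card {1..n}"
  proof (rule tower_colour_bound[OF h, where label = label])
    fix A v assume A: "A \<in> cover ?N t" and v: "v \<in> A"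
    obtain p u where pu: "v = (p, u)" by force
    have u: "cover_vertex ?N t p u" using coverD(1)[OF A] v pu by simp
    then have "fold_cover ?N (map (\<lambda>a. ?N - a) u) = fold_cover ?N u"
      by (auto simp: fold_cover_def cover_vertex_def min.commute)
    then show "label (antipode ?N v) = opposite (label v)"
      by (auto simp: pu antipode_def label_def opposite_def col_def)
    show "label v div 2 \<in> {1..n}"
      using c_eq(2)[OF u] by (auto simp: pu label_def)
    fix w assume w: "w \<in> A"
    obtain q x where qx: "w = (q, x)" by force
    have x: "cover_vertex ?N t q x" using coverD(1)[OF A] w qx by simp
    show "label w \<noteq> opposite (label v)"
    proof
      assume eq: "label w = opposite (label v)"
      have "label w div 2 = label v div 2" "odd (label w) \<longleftrightarrow> even (label v)"
        by (simp_all add: eq)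
      then have same: "col u = col x" and "q \<noteq> p"
        by (auto simp: pu qx label_def)
      then have "list_all2 near u x \<or> list_all2 near x u"
        using coverD(2)[OF A] v w pu qx by (cases p; cases q) auto
      then have "c (fold_cover ?N u) \<inter> c (fold_cover ?N x) = {}"
        using fold_cover_adjacent[OF assms(2) u x] fold_cover_adjacent[OF assms(2) x u] c
        unfolding fold_coloring_def by blast
      then show False using c_eq(1)[OF u] c_eq(1)[OF x] same by simp
    qed
  qed simp
  then show ?thesis by simp
qed

section \<open>The multichromatic numbers of W(s,t)\<close>

text \<open>
  If \<open>X\<close> contains both removed colours, its new element is the largest colour which \<open>X\<close> does not
  use; a set disjoint from \<open>X\<close> can only use it as its maximum, and loses it.
\<close>

definition drop_two :: "nat \<Rightarrow> nat set \<Rightarrow> nat set" where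
  "drop_two m X =
     (if {m + 1, m + 2} \<subseteq> X then insert (Max ({1..m} - X)) (X - {m + 1, m + 2}) else X - {Max X})"

lemma drop_two_card:
  assumes X: "X \<subseteq> {1..m + 2}" "card X = Suc r" and r: "1 \<le> r" "r \<le> m"
  shows "drop_two m X \<subseteq> {1..m}" "card (drop_two m X) = r"
proof -
  have fin: "finite X" using X(1) by (rule finite_subset) simp
  have "drop_two m X \<subseteq> {1..m} \<and> card (drop_two m X) = r"
  proof (cases "{m + 1, m + 2} \<subseteq> X")
    case True
    let ?Y = "X - {m + 1, m + 2}"
    have Y: "?Y \<subseteq> {1..m}" using X(1) by auto
    have card: "card ?Y = r - 1" using True X(2) by (subst card_Diff_subset) auto
    have "{1..m} - X \<noteq> {}"
    proof
      assume "{1..m} - X = {}"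
      then have "{1..m} \<subseteq> ?Y" by auto
      then have "card {1..m} \<le> card ?Y" using fin by (intro card_mono) auto
      then show False using card r by simp
    qed
    then have "Max ({1..m} - X) \<in> {1..m} - X" by (intro Max_in) auto
    then show ?thesis using True Y card r fin by (simp add: drop_two_def)
  next
    case False
    have "X \<noteq> {}" using X(2) by auto
    then have max: "Max X \<in> X" "\<And>x. x \<in> X \<Longrightarrow> x \<le> Max X" using fin by auto
    have "x \<le> m" if "x \<in> X" "x \<noteq> Max X" for x
    proof (rule ccontr)
      assume "\<not> x \<le> m"
      moreover have "x < Max X" "Max X \<le> m + 2" using max that X(1) by force+
      ultimately have "x = m + 1" "Max X = m + 2" by linarith+
      then show False using False that(1) max(1) by auto
    qed
    then have "X - {Max X} \<subseteq> {1..m}" using X(1) by fastforce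
    moreover have "drop_two m X = X - {Max X}"
      unfolding drop_two_def using False by (rule if_not_P)
    ultimately show ?thesis using X(2) max(1) fin by simp
  qed
  then show "drop_two m X \<subseteq> {1..m}" "card (drop_two m X) = r" by blast+
qed

lemma drop_two_disjoint:
  assumes X: "X \<subseteq> {1..m + 2}" and Y: "Y \<subseteq> {1..m + 2}" and disj: "X \<inter> Y = {}"
  shows "drop_two m X \<inter> drop_two m Y = {}"
proof -
  have *: "drop_two m X \<inter> drop_two m Y = {}"
    if X: "{m + 1, m + 2} \<subseteq> X" and Y: "Y \<subseteq> {1..m + 2}" and disj: "X \<inter> Y = {}" for X Y
  proof -
    have "y \<in> {1..m} - X" if "y \<in> Y" for y
    proof -
      have "y \<notin> X" "y \<le> m + 2" "1 \<le> y" using that Y disj by auto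
      moreover from this X have "y \<noteq> m + 1" "y \<noteq> m + 2" by auto
      ultimately show ?thesis by simp
    qed
    then have nY: "Y \<subseteq> {1..m} - X" by blast
    then have "m + 1 \<notin> Y" by auto
    then have n: "\<not> {m + 1, m + 2} \<subseteq> Y" by blast
    have "finite Y" using nY by (rule finite_subset) simp
    have "Max ({1..m} - X) \<notin> Y - {Max Y}"
    proof
      assume z: "Max ({1..m} - X) \<in> Y - {Max Y}"
      then have "Max Y \<in> Y" using \<open>finite Y\<close> by (intro Max_in) auto
      then have "Max Y \<le> Max ({1..m} - X)" using nY by (intro Max_ge) auto
      moreover have "Max ({1..m} - X) \<le> Max Y" using z \<open>finite Y\<close> by simp
      ultimately show False using z by simp
    qed
    then show ?thesis using X n disj by (auto simp: drop_two_def)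
  qed
  consider "{m + 1, m + 2} \<subseteq> X" | "{m + 1, m + 2} \<subseteq> Y"
    | "\<not> {m + 1, m + 2} \<subseteq> X" "\<not> {m + 1, m + 2} \<subseteq> Y" by blast
  then show ?thesis
  proof cases
    case 3
    then have "drop_two m X \<subseteq> X" "drop_two m Y \<subseteq> Y" by (auto simp: drop_two_def)
    then show ?thesis using disj by blast
  qed (use *[of X Y] *[of Y X] assms in blast)+
qed

lemma fold_coloring_drop_two:
  assumes G: "pair_graph G" and edge: "(a, b) \<in> parcs G" and r: "1 \<le> r"
    and c: "fold_coloring (Suc r) n G c"
  shows "2 \<le> n" "\<exists>d. fold_coloring r (n - 2) G d"
proof -
  interpret pair_graph G by fact
  have cv: "c v \<subseteq> {1..n}" "card (c v) = Suc r" if "v \<in> pverts G" for v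
    using c that by (auto simp: fold_coloring_def)
  have ce: "c u \<inter> c v = {}" if "(u, v) \<in> parcs G" for u v
    using c that by (auto simp: fold_coloring_def)
  have arc: "u \<in> pverts G" "v \<in> pverts G" if "(u, v) \<in> parcs G" for u v
    using arc_fst_in_verts[OF that] arc_snd_in_verts[OF that] by simp_all
  \<comment> \<open>The disjoint sets on one edge force \<open>2 * r + 2 \<le> n\<close>, so that
    \<open>m = n - 2\<close> satisfies the bound \<open>r \<le> m\<close> of
    \<open>drop_two_card\<close>.\<close>
  have "card (c a \<union> c b) = Suc r + Suc r"
    using cv[OF arc(1)[OF edge]] cv[OF arc(2)[OF edge]] ce[OF edge]
    by (subst card_Un_disjoint) (auto intro: finite_subset)
  moreover have "card (c a \<union> c b) \<le> card {1..n}"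
    using cv(1)[OF arc(1)[OF edge]] cv(1)[OF arc(2)[OF edge]] by (intro card_mono) auto
  ultimately have n: "2 * r + 2 \<le> n" by simp
  then show "2 \<le> n" by simp
  obtain m where m: "n = m + 2" "r \<le> m" using n by (auto intro: that[of "n - 2"])
  have "fold_coloring r (n - 2) G (\<lambda>v. drop_two m (c v))"
    unfolding fold_coloring_def
  proof (intro conjI ballI)
    fix v assume "v \<in> pverts G"
    then show "drop_two m (c v) \<subseteq> {1..n - 2}" "card (drop_two m (c v)) = r"
      using drop_two_card[OF _ _ r m(2), of "c v"] cv[of v] m(1) by simp_all
  next
    fix e assume "e \<in> parcs G"
    then obtain u v where e: "e = (u, v)" "(u, v) \<in> parcs G" by (cases e) auto
    have "drop_two m (c u) \<inter> drop_two m (c v) = {}"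
      using drop_two_disjoint[of "c u" m "c v"] cv(1) arc[OF e(2)] ce[OF e(2)] m(1) by simp
    then show "case e of (u, v) \<Rightarrow> drop_two m (c u) \<inter> drop_two m (c v) = {}" by (simp add: e(1))
  qed
  then show "\<exists>d. fold_coloring r (n - 2) G d" by blast
qed

lemma W_edge:
  assumes "1 \<le> s" "2 \<le> t"
  shows "\<exists>x y. (x, y) \<in> parcs (W s t)"
proof -
  let ?z = "replicate (t - 2) s"
  have len: "length (a # b # ?z) = t" for a b using assms(2) by simp
  have "count_list ?z 0 = 0" using assms(1) by (simp add: count_list_0_iff)
  then have "0 # 1 # ?z \<in> W_verts s t" "1 # 0 # ?z \<in> W_verts s t"
    using len assms by (auto simp: W_verts_iff)
  moreover have "\<bar>int ((0 # 1 # ?z) ! i) - int ((1 # 0 # ?z) ! i)\<bar> = 1 \<or>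
      (0 # 1 # ?z) ! i = s \<and> (1 # 0 # ?z) ! i = s" if "i < t" for i
  proof -
    consider "i = 0" | "i = 1" | k where "i = Suc (Suc k)"
      by (metis One_nat_def not0_implies_Suc)
    then show ?thesis using that by cases auto
  qed
  ultimately have "(0 # 1 # ?z, 1 # 0 # ?z) \<in> parcs (W s t)"
    unfolding parcs_W_iff by blast
  then show ?thesis by blast
qed

lemma fold_coloring_W_lower_bound:
  assumes "2 \<le> t" "1 \<le> s" "fold_coloring (Suc r) n (W s t) c"
  shows "t + 2 * r \<le> n"
  using assms(3)
proof (induction r arbitrary: n c)
  case 0
  then show ?case using coloring_lower_bound[OF assms(1,2)] by simp
next
  case (Suc r)
  obtain x y where "(x, y) \<in> parcs (W s t)" using W_edge[OF assms(2,1)] by blast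
  from fold_coloring_drop_two[OF pair_graph_W[OF assms(2)] this _ Suc.prems]
  obtain d where "2 \<le> n" "fold_coloring (Suc r) (n - 2) (W s t) d" by auto
  then show ?case using Suc.IH by fastforce
qed

section \<open>Independent sets for the upper bound\<close>

text \<open>
  The parity of \<open>m\<close> tells whether the coordinates are read from the left or from the right. The two
  sets of the pair \<open>m\<close> ask for the parity of the first coordinate below the threshold. A vertex which
  belongs to neither has a coordinate equal to \<open>threshold m\<close>, and the set of this coordinate
  compensates for the loss.
\<close>

definition threshold :: "nat \<Rightarrow> nat" where
  "threshold m = 2 * (m div 2) + 2"

definition before :: "nat \<Rightarrow> nat \<Rightarrow> nat \<Rightarrow> bool" where
  "before m j k \<longleftrightarrow> (if even m then j < k else k < j)"

definition first_below :: "nat \<Rightarrow> nat list \<Rightarrow> nat \<Rightarrow> bool" where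
  "first_below m x k \<longleftrightarrow>
     k < length x \<and> x ! k < threshold m \<and> (\<forall>j<length x. before m j k \<longrightarrow> threshold m \<le> x ! j)"

definition even_class :: "nat \<Rightarrow> nat list \<Rightarrow> bool" where
  "even_class m x \<longleftrightarrow> (\<exists>k. first_below m x k \<and> even (x ! k))"

definition odd_class :: "nat \<Rightarrow> nat list \<Rightarrow> bool" where
  "odd_class m x \<longleftrightarrow> (\<exists>k. first_below m x k \<and> odd (x ! k) \<and>
     (\<forall>j<length x. before m j k \<longrightarrow> x ! j \<noteq> threshold m))"

text \<open>The second alternative is only needed for the threshold \<open>threshold m = s\<close>.\<close>

definition coordinate_class :: "nat \<Rightarrow> nat \<Rightarrow> nat list \<Rightarrow> bool" where
  "coordinate_class s k x \<longleftrightarrow> even (x ! k) \<and>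
     (x ! k < s \<or> Suc k < length x \<and> odd (x ! Suc k) \<and> x ! Suc k < s)"

lemma even_threshold [simp]: "even (threshold m)"
  by (simp add: threshold_def)

lemma W_adjacentD:
  assumes "(x, y) \<in> parcs (W s t)" "i < t"
  shows "x ! i = Suc (y ! i) \<or> y ! i = Suc (x ! i) \<or> x ! i = s \<and> y ! i = s"
  using assms by (auto simp: parcs_W_iff)

lemma W_length:
  assumes "(x, y) \<in> parcs (W s t)"
  shows "length x = t" "length y = t"
  using assms by (simp_all add: parcs_W_iff W_verts_iff)

lemma W_le:
  assumes "x \<in> W_verts s t" "i < t"
  shows "x ! i \<le> s"
  using assms by (simp add: W_verts_def)

lemma before_total: "before m j k \<or> j = k \<or> before m k j"
  by (auto simp: before_def)

text \<open>An even entry below the even threshold is at least 2 below it, so the adjacent entry is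
  below as well. Hence the two first positions agree, and there adjacent entries differ in
  parity.\<close>

lemma even_class_independent:
  assumes e: "(x, y) \<in> parcs (W s t)" and m: "threshold m \<le> s" and "even_class m x"
  shows "\<not> even_class m y"
proof
  assume "even_class m y"
  with assms(3) obtain k l where k: "first_below m x k" "even (x ! k)"
    and l: "first_below m y l" "even (y ! l)"
    by (auto simp: even_class_def)
  have kl: "k < t" "l < t" "x ! k < threshold m" "y ! l < threshold m"
    using k(1) l(1) W_length[OF e] by (auto simp: first_below_def)
  have "x ! k \<noteq> threshold m - 1" "y ! l \<noteq> threshold m - 1"
    using k(2) l(2) by (auto simp: threshold_def)
  then have y: "y ! k < threshold m" "odd (y ! k)" "x ! l < threshold m"
    using W_adjacentD[OF e kl(1)] W_adjacentD[OF e kl(2)] kl m k(2) by (auto simp: threshold_def)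
  then have "\<not> before m k l" "\<not> before m l k"
    using k(1) l(1) kl W_length[OF e] by (auto simp: first_below_def)
  then show False using before_total[of m k l] y(2) l(2) by simp
qed

text \<open>If the first position of \<open>x\<close> came earlier, \<open>y\<close> would exceed
  the threshold there, as equality is excluded by the class, while \<open>x\<close> is below it: the
  entries would differ by at least 2.\<close>

lemma odd_class_independent:
  assumes e: "(x, y) \<in> parcs (W s t)" and m: "threshold m \<le> s" and "odd_class m x"
  shows "\<not> odd_class m y"
proof
  assume "odd_class m y"
  with assms(3) obtain k l where
    k: "first_below m x k" "odd (x ! k)" "\<forall>j<length x. before m j k \<longrightarrow> x ! j \<noteq> threshold m" and
    l: "first_below m y l" "odd (y ! l)" "\<forall>j<length y. before m j l \<longrightarrow> y ! j \<noteq> threshold m"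
    by (auto simp: odd_class_def)
  note len = W_length[OF e]
  have kl: "k < t" "l < t" "x ! k < threshold m" "y ! l < threshold m"
    using k(1) l(1) len by (auto simp: first_below_def)
  have "threshold m < y ! k" if "before m k l"
  proof (rule le_neq_trans)
    show "threshold m \<le> y ! k" using l(1) that kl len by (simp add: first_below_def)
    show "threshold m \<noteq> y ! k" using l(3) that kl len by metis
  qed
  then have 1: "\<not> before m k l" using W_adjacentD[OF e kl(1)] kl m by linarith
  have "threshold m < x ! l" if "before m l k"
  proof (rule le_neq_trans)
    show "threshold m \<le> x ! l" using k(1) that kl len by (simp add: first_below_def)
    show "threshold m \<noteq> x ! l" using k(3) that kl len by metis
  qed
  then have 2: "\<not> before m l k" using W_adjacentD[OF e kl(2)] kl m by linarith
  from 1 2 have "k = l" using before_total by blast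
  then show False using W_adjacentD[OF e kl(1)] kl m k(2) l(2) by auto
qed

text \<open>Adjacent entries of equal parity both equal \<open>s\<close>, which leaves the second
  alternative; but two odd entries below \<open>s\<close> at the next position contradict
  adjacency.\<close>

lemma coordinate_class_independent:
  assumes e: "(x, y) \<in> parcs (W s t)" and k: "k < t" and "coordinate_class s k x"
  shows "\<not> coordinate_class s k y"
proof
  assume y: "coordinate_class s k y"
  have "x ! k = s" "y ! k = s"
    using W_adjacentD[OF e k] assms(3) y by (auto simp: coordinate_class_def)
  then have "Suc k < t" "odd (x ! Suc k)" "odd (y ! Suc k)" "x ! Suc k < s"
    using assms(3) y W_length[OF e] by (auto simp: coordinate_class_def)
  then show False using W_adjacentD[OF e, of "Suc k"] by auto
qed

lemma ex_first_below:
  assumes "x \<in> W_verts s t"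
  shows "\<exists>k. first_below m x k"
proof -
  define A where "A = {k. k < length x \<and> x ! k < threshold m}"
  have fin: "finite A" by (simp add: A_def)
  obtain i where "i < length x" "x ! i = 0" using assms by (auto simp: W_verts_def)
  then have "A \<noteq> {}" by (auto simp: A_def threshold_def)
  then have "Min A \<in> A" "Max A \<in> A" using fin by simp_all
  moreover have "threshold m \<le> x ! j" if "j < length x" "j < Min A \<or> Max A < j" for j
  proof (rule ccontr)
    assume "\<not> threshold m \<le> x ! j"
    then have "j \<in> A" using that(1) by (simp add: A_def)
    then show False using Min_le[OF fin] Max_ge[OF fin] that(2) leD by blast
  qed
  ultimately have "first_below m x (if even m then Min A else Max A)"
    unfolding first_below_def before_def by (simp add: A_def)
  then show ?thesis by blast
qed

lemma compensating_coordinate: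
  assumes x: "x \<in> W_verts s t" and m: "m + 2 \<le> s"
    and no: "\<not> even_class m x" "\<not> odd_class m x"
  shows "\<exists>j<t. coordinate_class s j x \<and> x ! j = threshold m \<and> (\<exists>k. first_below m x k \<and> before m j k)"
proof -
  obtain k where k: "first_below m x k" using ex_first_below[OF x] by blast
  have len: "length x = t" using x by (simp add: W_verts_def)
  have odd: "odd (x ! k)" using k no(1) by (auto simp: even_class_def)
  then obtain j where j: "j < t" "before m j k" "x ! j = threshold m"
    using k no(2) len by (auto simp: odd_class_def)
  show ?thesis
  proof (cases "threshold m < s")
    case True
    then show ?thesis using j k by (auto simp: coordinate_class_def)
  next
    case False
    \<comment> \<open>The bound on \<open>m\<close> lets the threshold reach \<open>s\<close> only
      when reading from the left. All entries before \<open>k\<close> then equal \<open>s\<close>,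
      and the one just before \<open>k\<close> falls under the second alternative of
      \<open>coordinate_class\<close>.\<close>
    then have "even m" "threshold m = s" using m unfolding threshold_def by presburger+
    then have "j < k" using j(2) by (simp add: before_def)
    then have "k - 1 < t" "before m (k - 1) k" "Suc (k - 1) = k"
      using k len \<open>even m\<close> by (auto simp: before_def first_below_def)
    moreover from this have "x ! (k - 1) = s"
      using k len \<open>threshold m = s\<close> W_le[OF x] by (auto simp: first_below_def intro: antisym)
    moreover have "k < t" "x ! k < s" "even s"
      using k len \<open>threshold m = s\<close> even_threshold[of m] by (auto simp: first_below_def)
    ultimately show ?thesis
      using k odd len \<open>threshold m = s\<close> by (intro exI[of _ "k - 1"]) (auto simp: coordinate_class_def)
  qed
qed

text \<open>Equal thresholds with \<open>m \<noteq> n\<close> mean one reading from each side. The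
  leftmost entry below the threshold is not to the right of the rightmost one, so no position is
  left of the former and right of the latter.\<close>

lemma compensating_coordinates_distinct:
  assumes "first_below m x k" "before m j k" "x ! j = threshold m" "j < length x"
    and "first_below n x l" "before n i l" "x ! i = threshold n" "i < length x" and "m \<noteq> n"
  shows "i \<noteq> j"
proof
  assume "i = j"
  then have "threshold m = threshold n" using assms(3,7) by simp
  moreover from this have "odd m \<noteq> odd n"
    using assms(9) unfolding threshold_def by presburger
  moreover have "k < length x" "l < length x" "x ! k < threshold m" "x ! l < threshold n"
    using assms(1,5) by (auto simp: first_below_def)
  ultimately have "\<not> before m l k" "\<not> before n k l" "even m \<longleftrightarrow> odd n"
    using assms(1,5) by (auto simp: first_below_def)
  then show False
    using assms(2,6) \<open>i = j\<close> by (auto simp: before_def split: if_splits)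
qed

definition colour_class :: "nat \<Rightarrow> nat \<Rightarrow> nat list \<Rightarrow> nat \<Rightarrow> bool" where
  "colour_class s t x i \<longleftrightarrow>
     (if i < t then coordinate_class s i x
      else if even (i - t) then even_class ((i - t) div 2) x
      else odd_class ((i - t) div 2) x)"

lemma colour_class_independent:
  assumes e: "(x, y) \<in> parcs (W s t)" and i: "i < t + 2 * q" and q: "Suc q \<le> s"
    and "colour_class s t x i"
  shows "\<not> colour_class s t y i"
proof (cases "i < t")
  case True
  then show ?thesis
    using coordinate_class_independent[OF e True] assms(4) by (simp add: colour_class_def)
next
  case False
  then have "threshold ((i - t) div 2) \<le> s" using i q by (auto simp: threshold_def)
  then show ?thesis
    using False even_class_independent[OF e] odd_class_independent[OF e] assms(4)
    by (simp add: colour_class_def split: if_splits)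
qed

lemma colour_class_cover:
  assumes x: "x \<in> W_verts s t" and q: "Suc q \<le> s"
  shows "Suc q \<le> card {i. i < t + 2 * q \<and> colour_class s t x i}"
proof -
  have len: "length x = t" using x by (simp add: W_verts_def)
  \<comment> \<open>The indices that can be charged to the pair \<open>m\<close>: its own two
    classes, or a compensating coordinate. Different pairs never share one.\<close>
  define good where "good m i \<longleftrightarrow> (i = t + 2 * m \<or> i = t + 2 * m + 1) \<or>
    (i < t \<and> x ! i = threshold m \<and> (\<exists>k. first_below m x k \<and> before m i k))" for m i
  have ex: "\<exists>i. i < t + 2 * q \<and> colour_class s t x i \<and> good m i" if "m < q" for m
  proof -
    consider "even_class m x" | "odd_class m x" | "\<not> even_class m x" "\<not> odd_class m x" by blast
    then show ?thesis
    proof cases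
      case 1
      then show ?thesis
        using that by (intro exI[of _ "t + 2 * m"]) (simp add: colour_class_def good_def)
    next
      case 2
      then show ?thesis
        using that by (intro exI[of _ "t + 2 * m + 1"]) (simp add: colour_class_def good_def)
    next
      case 3
      have m: "m + 2 \<le> s" using that q by simp
      from compensating_coordinate[OF x m 3] obtain j where
        j: "j < t \<and> coordinate_class s j x \<and> x ! j = threshold m \<and>
          (\<exists>k. first_below m x k \<and> before m j k)" ..
      then have "good m j" unfolding good_def by blast
      moreover have "colour_class s t x j" using j by (simp add: colour_class_def)
      ultimately show ?thesis using j by (intro exI[of _ j]) simp
    qed
  qed
  define g where "g m = (SOME i. i < t + 2 * q \<and> colour_class s t x i \<and> good m i)" for m
  have g: "g m < t + 2 * q" "colour_class s t x (g m)" "good m (g m)" if "m < q" for m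
    using someI_ex[OF ex[OF that]] by (simp_all add: g_def)
  have inj: "inj_on g {..<q}"
  proof (rule inj_onI, rule ccontr)
    fix m n assume mn: "m \<in> {..<q}" "n \<in> {..<q}" "g m = g n" "m \<noteq> n"
    then have good: "good m (g m)" "good n (g m)" using g(3)[of m] g(3)[of n] by simp_all
    show False
    proof (cases "g m < t")
      case True
      with good obtain k l where "first_below m x k" "before m (g m) k" "x ! g m = threshold m"
        "first_below n x l" "before n (g m) l" "x ! g m = threshold n"
        unfolding good_def by auto
      then show False
        using compensating_coordinates_distinct[of m x k "g m" n l "g m"] mn(4) True len by simp
    next
      case False
      then have "g m = t + 2 * m \<or> g m = t + 2 * m + 1" "g m = t + 2 * n \<or> g m = t + 2 * n + 1"
        using good unfolding good_def by blast+
      then show False using mn(4) by presburger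
    qed
  qed
  \<comment> \<open>The zero entry gives one more class: thresholds are at least 2, so this
    coordinate is never a compensating one.\<close>
  obtain z where z: "z < t" "x ! z = 0" using x by (auto simp: W_verts_def)
  then have "colour_class s t x z" using q by (simp add: colour_class_def coordinate_class_def)
  have "z \<notin> g ` {..<q}"
  proof
    assume "z \<in> g ` {..<q}"
    then obtain m where "m < q" "z = g m" by auto
    then show False using g(3)[of m] z by (auto simp: good_def threshold_def)
  qed
  then have "card (insert z (g ` {..<q})) = Suc q"
    using inj by (simp add: card_image)
  moreover have "insert z (g ` {..<q}) \<subseteq> {i. i < t + 2 * q \<and> colour_class s t x i}"
    using g(1,2) z(1) \<open>colour_class s t x z\<close> by auto
  moreover have "finite {i. i < t + 2 * q \<and> colour_class s t x i}" by simp
  ultimately show ?thesis using card_mono by metis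
qed

lemma fold_coloring_W:
  assumes "Suc q \<le> s"
  shows "\<exists>c. fold_coloring (Suc q) (t + 2 * q) (W s t) c"
proof -
  let ?S = "\<lambda>x. {i. i < t + 2 * q \<and> colour_class s t x i}"
  have "\<exists>C. C \<subseteq> ?S x \<and> card C = Suc q" if "x \<in> W_verts s t" for x
    using obtain_subset_with_card_n[OF colour_class_cover[OF that assms]] by metis
  then obtain C where C: "\<And>x. x \<in> W_verts s t \<Longrightarrow> C x \<subseteq> ?S x"
    "\<And>x. x \<in> W_verts s t \<Longrightarrow> card (C x) = Suc q"
    by metis
  have "fold_coloring (Suc q) (t + 2 * q) (W s t) (\<lambda>x. Suc ` C x)"
    unfolding fold_coloring_def pverts_W
  proof (intro conjI ballI)
    fix x assume "x \<in> W_verts s t"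
    from C[OF this] show "Suc ` C x \<subseteq> {1..t + 2 * q}" "card (Suc ` C x) = Suc q"
      by (auto simp: card_image)
  next
    fix e assume "e \<in> parcs (W s t)"
    then obtain x y where e: "e = (x, y)" "(x, y) \<in> parcs (W s t)" by (cases e) auto
    have "C x \<subseteq> ?S x" "C y \<subseteq> ?S y" using C(1) e(2) by (auto simp: parcs_W_iff)
    then have "C x \<inter> C y = {}" using colour_class_independent[OF e(2) _ assms] by blast
    then show "case e of (x, y) \<Rightarrow> Suc ` C x \<inter> Suc ` C y = {}" by (auto simp: e(1))
  qed
  then show ?thesis by blast
qed

theorem corollary4:
  fixes r s t :: nat
  assumes "1 \<le> r" and "r \<le> s" and "t \<ge> 2"
  shows "fold_chromatic_number r (W s t) = t + 2 * (r - 1)"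
proof -
  obtain q where q: "r = Suc q" using assms(1) by (cases r) auto
  show ?thesis
    unfolding fold_chromatic_number_def q
    using fold_coloring_W[of q s t] fold_coloring_W_lower_bound[of t s q] assms q
    by (intro Least_equality) auto
qed

end
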